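(* For $m\ge1$ let $f_m:\{0,1\}^{m^2}\to\{0,1\}$ be the total Boolean function $f_m=\mathsf{AND}_m\circ(\lnot\mathsf{Exact}_{1,m})$; that is, the input consists of $m$ blocks $x_i=(x_{i,1},\dots,x_{i,m})\in\{0,1\}^m$, $i=1,\dots,m$, and $f_m(x)=1$ if and only if no block $x_i$ has Hamming weight exactly $1$. Then 1. $\mathsf{Q}_0(f_m)=O\left(m^{3/2}\right)$; 2. $\mathsf{Q}(f_m)=O(m)$.
   Context: In the standard quantum query model, for a Boolean function $f:\mathcal{D}\subseteq\{0,1\}^n\to\{0,1\}$: $\mathsf{Q}(f)$ is the minimum number of queries of a quantum query algorithm that on every $x\in\mathcal{D}$ outputs $f(x)$ with probability at least $2/3$. $\mathsf{Q}_0(f)$ is the minimum number of queries of a quantum algorithm with outputs in $\{0,1,\bot\}$ that, on every $x\in\mathcal{D}$, outputs $\bot$ with probability at most $1/2$ and never outputs $1-f(x)$. $\mathsf{Exact}_{1,m}(z_1,\dots,z_m)=1$ iff the Hamming weight of $z$ equals $1$. *)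

theory Defs
  imports
    "Jordan_Normal_Form.Schur_Decomposition"
    "HOL-Library.Landau_Symbols"
begin

definition unitary_mat :: "nat \<Rightarrow> complex mat \<Rightarrow> bool" where
  "unitary_mat d U \<longleftrightarrow> U \<in> carrier_mat d d \<and> mat_adjoint U * U = 1\<^sub>m d"

(* Inputs x in {0,1}^n are lists of length n, entries indexed from 0; throughout, n \<ge> 1.

   The state space has a workspace register w < W, a query register i < n and an answer
   qubit b in {0,1}. The basis state |w,i,b> is the unit vector number k = w * (2 * n) + 2 * i + b,
   so that i = (k div 2) mod n and b = k mod 2.

   The query operator is the standard O_x |w,i,b> = |w,i,b XOR x_i>. *)

definition query_dim :: "nat \<Rightarrow> nat \<Rightarrow> nat" where
  "query_dim n W = W * (2 * n)"

definition query_perm :: "nat \<Rightarrow> bool list \<Rightarrow> nat \<Rightarrow> nat" where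
  "query_perm n x k =
     (if x ! ((k div 2) mod n) then (if even k then k + 1 else k - 1) else k)"

definition query_mat :: "nat \<Rightarrow> nat \<Rightarrow> bool list \<Rightarrow> complex mat" where
  "query_mat n W x = mat (query_dim n W) (query_dim n W)
     (\<lambda>(r, c). if r = query_perm n x c then 1 else 0)"

(* gate t is the input-independent unitary applied after t queries; the final state is
   U_T O_x U_{T-1} O_x ... O_x U_0 |0,0,0>. It is measured in the computational basis and
   the outcome k is reported as readout k. *)

record 'o query_algorithm =
  queries :: nat
  workspace :: nat
  gate :: "nat \<Rightarrow> complex mat"
  readout :: "nat \<Rightarrow> 'o"

definition query_algorithm_on :: "nat \<Rightarrow> 'o query_algorithm \<Rightarrow> bool" where
  "query_algorithm_on n A \<longleftrightarrow>
     workspace A \<ge> 1 \<and> (\<forall>t\<le>queries A. unitary_mat (query_dim n (workspace A)) (gate A t))"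

primrec query_state :: "nat \<Rightarrow> 'o query_algorithm \<Rightarrow> bool list \<Rightarrow> nat \<Rightarrow> complex vec" where
  "query_state n A x 0 = gate A 0 *\<^sub>v unit_vec (query_dim n (workspace A)) 0"
| "query_state n A x (Suc t) =
     gate A (Suc t) *\<^sub>v (query_mat n (workspace A) x *\<^sub>v query_state n A x t)"

definition output_prob :: "nat \<Rightarrow> 'o query_algorithm \<Rightarrow> bool list \<Rightarrow> 'o \<Rightarrow> real" where
  "output_prob n A x v =
     (\<Sum>k | k < query_dim n (workspace A) \<and> readout A k = v.
        (cmod (query_state n A x (queries A) $ k))\<^sup>2)"

(* Complexity of f : D -> {0,1} with D a subset of {0,1}^n; values of f outside D are irrelevant. *)

definition computes_bounded_error ::
  "nat \<Rightarrow> bool list set \<Rightarrow> (bool list \<Rightarrow> bool) \<Rightarrow> bool query_algorithm \<Rightarrow> bool" where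
  "computes_bounded_error n D f A \<longleftrightarrow>
     query_algorithm_on n A \<and> (\<forall>x\<in>D. output_prob n A x (f x) \<ge> 2 / 3)"

(* The output None is the inconclusive answer. *)
definition computes_zero_error ::
  "nat \<Rightarrow> bool list set \<Rightarrow> (bool list \<Rightarrow> bool) \<Rightarrow> bool option query_algorithm \<Rightarrow> bool" where
  "computes_zero_error n D f A \<longleftrightarrow>
     query_algorithm_on n A \<and>
     (\<forall>x\<in>D. output_prob n A x None \<le> 1 / 2 \<and> output_prob n A x (Some (\<not> f x)) = 0)"

(* If no algorithm existed, LEAST would be an unspecified number, about which no bound is provable. *)

definition Q_bounded_error :: "nat \<Rightarrow> bool list set \<Rightarrow> (bool list \<Rightarrow> bool) \<Rightarrow> nat" where
  "Q_bounded_error n D f = (LEAST T. \<exists>A. computes_bounded_error n D f A \<and> queries A = T)"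

definition Q_zero_error :: "nat \<Rightarrow> bool list set \<Rightarrow> (bool list \<Rightarrow> bool) \<Rightarrow> nat" where
  "Q_zero_error n D f = (LEAST T. \<exists>A. computes_zero_error n D f A \<and> queries A = T)"

definition boolean_cube :: "nat \<Rightarrow> bool list set" where
  "boolean_cube n = {x. length x = n}"

(* AND_m and Exact_{1,m} take m from the length of their argument. *)

definition AND_fn :: "bool list \<Rightarrow> bool" where
  "AND_fn z \<longleftrightarrow> (\<forall>b\<in>set z. b)"

definition hamming_weight :: "bool list \<Rightarrow> nat" where
  "hamming_weight z = card {j. j < length z \<and> z ! j}"

definition Exact_one :: "bool list \<Rightarrow> bool" where
  "Exact_one z \<longleftrightarrow> hamming_weight z = 1"

(* Block composition h o g on k blocks of m bits: bit j of block i is entry i * m + j. *)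

definition block :: "nat \<Rightarrow> bool list \<Rightarrow> nat \<Rightarrow> bool list" where
  "block m x i = map (\<lambda>j. x ! (i * m + j)) [0..<m]"

definition block_compose ::
  "nat \<Rightarrow> nat \<Rightarrow> (bool list \<Rightarrow> bool) \<Rightarrow> (bool list \<Rightarrow> bool) \<Rightarrow> bool list \<Rightarrow> bool" where
  "block_compose k m h g x = h (map (\<lambda>i. g (block m x i)) [0..<k])"

definition f_and_not_exact :: "nat \<Rightarrow> bool list \<Rightarrow> bool" where
  "f_and_not_exact m = block_compose m m AND_fn (\<lambda>z. \<not> Exact_one z)"

end

theory Submission
  imports Defs "HOL-Analysis.L2_Norm"
begin

text \<open>
  Part 1: exact Grover search, tuned to a single marked position, is run twice on a block. It finds a
  unique one with certainty both times, while for every other Hamming weight both runs return the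
  same position with probability at most 1/2. Hence \<open>O(sqrt m)\<close> queries certify with probability at
  least 1/2 that a block does not have weight 1, and never do so wrongly. Iterating over the blocks,
  \<open>5 m\<close> tests get past all good blocks with probability at least 1/2; if they do not, the block
  at which they stop is read with \<open>m\<close> further queries.

  Part 2: composing explicit dual adversary vectors for \<open>Exact\<close> (of size \<open>O(sqrt m)\<close>) with those
  for \<open>AND\<close> gives vectors of size \<open>O(m)\<close>, with no logarithmic loss. They are turned into an algorithm
  that averages the powers of a product \<open>U\<close> of two reflections over the start vector \<open>e\<close>. For
  accepted inputs, \<open>e\<close> is close to a fixed vector of \<open>U\<close>; for rejected inputs, \<open>e = (w - U w) / 2\<close> for
  a vector \<open>w\<close> of norm \<open>O(m)\<close>, so that the average over \<open>T\<close> powers telescopes and has norm at most \<open>|w| / T\<close>.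
\<close>

section \<open>Unitary operators\<close>

text \<open>A block that is to be certified may have weight 0, and then no position in it witnesses
  that the weight differs from 1. Comparing two runs needs no witness: weight 1 makes the outcome
  deterministic, every other weight spreads it. Since a bad block is never passed, a search that
  reaches one stays there, and reading it proves rejection. The inconclusive answer arises only from
  stopping at a good block; a moment bound on the number of blocks left controls this.

  In part 2 only the product of the two vector sizes matters. Accepted inputs pay one unit for each
  of the \<open>m\<close> blocks, rejected inputs at most \<open>3 * m\<close> for one bad block,
  and the geometric mean is O(m). Averaging powers of the iteration takes the place of phase
  estimation: explicit vectors on both sides suffice, and no eigenvalues or spectral gaps enter.

  Both algorithms are assembled in a sign-query model closed under gates, queries and sequential
  composition; a single translation, without extra queries, leads to the matrices of the
  definitions.\<close>

definition ip :: "nat \<Rightarrow> (nat \<Rightarrow> complex) \<Rightarrow> (nat \<Rightarrow> complex) \<Rightarrow> complex" where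
  "ip d \<phi> \<psi> = (\<Sum>s<d. cnj (\<phi> s) * \<psi> s)"

definition nsq :: "nat \<Rightarrow> (nat \<Rightarrow> complex) \<Rightarrow> real" where
  "nsq d \<psi> = (\<Sum>s<d. (cmod (\<psi> s))\<^sup>2)"

definition delta :: "nat \<Rightarrow> nat \<Rightarrow> complex" where
  "delta a s = (if s = a then 1 else 0)"

text \<open>States on the labels \<open>{..<d}\<close> are functions whose values at other labels are irrelevant, and
  gates are operators on such functions.\<close>

definition linear_op :: "((nat \<Rightarrow> complex) \<Rightarrow> nat \<Rightarrow> complex) \<Rightarrow> bool" where
  "linear_op F \<longleftrightarrow>
     (\<forall>\<psi> \<phi>. F (\<lambda>s. \<psi> s + \<phi> s) = (\<lambda>s. F \<psi> s + F \<phi> s)) \<and>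
     (\<forall>c \<psi>. F (\<lambda>s. c * \<psi> s) = (\<lambda>s. c * F \<psi> s))"

definition unitary_op :: "nat \<Rightarrow> ((nat \<Rightarrow> complex) \<Rightarrow> nat \<Rightarrow> complex) \<Rightarrow> bool" where
  "unitary_op d F \<longleftrightarrow> linear_op F \<and> (\<forall>\<psi> \<phi>. ip d (F \<psi>) (F \<phi>) = ip d \<psi> \<phi>)"

lemma ip_cong:
  "(\<And>s. s < d \<Longrightarrow> \<phi> s = \<phi>' s) \<Longrightarrow> (\<And>s. s < d \<Longrightarrow> \<psi> s = \<psi>' s) \<Longrightarrow> ip d \<phi> \<psi> = ip d \<phi>' \<psi>'"
  by (simp add: ip_def)

lemma nsq_cong: "(\<And>s. s < d \<Longrightarrow> \<phi> s = \<phi>' s) \<Longrightarrow> nsq d \<phi> = nsq d \<phi>'"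
  by (simp add: nsq_def)

lemma ip_self: "ip d \<psi> \<psi> = of_real (nsq d \<psi>)"
  unfolding ip_def nsq_def of_real_sum
  by (intro sum.cong refl) (simp add: complex_norm_square[symmetric] mult.commute)

lemma nsq_nonneg: "nsq d \<psi> \<ge> 0"
  by (simp add: nsq_def sum_nonneg)

lemma nsq_eq_0: "nsq d \<psi> = 0 \<Longrightarrow> s < d \<Longrightarrow> \<psi> s = 0"
  unfolding nsq_def by (subst (asm) sum_nonneg_eq_0_iff) auto

lemma ip_add_left: "ip d (\<lambda>s. \<phi> s + \<chi> s) \<psi> = ip d \<phi> \<psi> + ip d \<chi> \<psi>"
  by (simp add: ip_def algebra_simps sum.distrib)

lemma ip_add_right: "ip d \<psi> (\<lambda>s. \<phi> s + \<chi> s) = ip d \<psi> \<phi> + ip d \<psi> \<chi>"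
  by (simp add: ip_def algebra_simps sum.distrib)

lemma ip_diff_left: "ip d (\<lambda>s. \<phi> s - \<chi> s) \<psi> = ip d \<phi> \<psi> - ip d \<chi> \<psi>"
  by (simp add: ip_def algebra_simps sum_subtractf)

lemma ip_diff_right: "ip d \<psi> (\<lambda>s. \<phi> s - \<chi> s) = ip d \<psi> \<phi> - ip d \<psi> \<chi>"
  by (simp add: ip_def algebra_simps sum_subtractf)

lemma ip_scale_left: "ip d (\<lambda>s. c * \<phi> s) \<psi> = cnj c * ip d \<phi> \<psi>"
  by (simp add: ip_def algebra_simps sum_distrib_left)

lemma ip_scale_right: "ip d \<psi> (\<lambda>s. c * \<phi> s) = c * ip d \<psi> \<phi>"
  by (simp add: ip_def algebra_simps sum_distrib_left)

lemmas ip_simps = ip_add_left ip_add_right ip_diff_left ip_diff_right ip_scale_left ip_scale_right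

lemma cnj_ip: "cnj (ip d \<phi> \<psi>) = ip d \<psi> \<phi>"
  by (simp add: ip_def mult.commute)

lemma ip_delta: "s < d \<Longrightarrow> ip d (delta s) \<psi> = \<psi> s"
proof -
  assume "s < d"
  have "ip d (delta s) \<psi> = (\<Sum>t<d. if t = s then \<psi> t else 0)"
    unfolding ip_def delta_def by (rule sum.cong) auto
  then show ?thesis using \<open>s < d\<close> by simp
qed

lemma linear_add: "linear_op F \<Longrightarrow> F (\<lambda>s. \<psi> s + \<phi> s) = (\<lambda>s. F \<psi> s + F \<phi> s)"
  by (simp add: linear_op_def)

lemma linear_scale: "linear_op F \<Longrightarrow> F (\<lambda>s. c * \<psi> s) = (\<lambda>s. c * F \<psi> s)"
  by (simp add: linear_op_def)

lemma linear_diff: "linear_op F \<Longrightarrow> F (\<lambda>s. \<psi> s - \<phi> s) = (\<lambda>s. F \<psi> s - F \<phi> s)"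
  using linear_add[of F \<psi> "\<lambda>s. - 1 * \<phi> s"] linear_scale[of F "- 1" \<phi>] by simp

lemma linear_zero: "linear_op F \<Longrightarrow> F (\<lambda>s. 0) = (\<lambda>s. 0)"
  using linear_scale[of F 0 "\<lambda>_. 0"] by simp

lemma linear_sum: "linear_op F \<Longrightarrow> F (\<lambda>s. \<Sum>i<(k::nat). \<psi> i s) = (\<lambda>s. \<Sum>i<k. F (\<psi> i) s)"
proof (induction k)
  case 0 then show ?case by (simp add: linear_zero)
next
  case (Suc k) then show ?case using linear_add[OF Suc.prems, of "\<lambda>s. \<Sum>i<k. \<psi> i s" "\<psi> k"] by simp
qed

lemma unitary_linear: "unitary_op d F \<Longrightarrow> linear_op F"
  by (simp add: unitary_op_def)

lemma unitary_ip: "unitary_op d F \<Longrightarrow> ip d (F \<psi>) (F \<phi>) = ip d \<psi> \<phi>"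
  by (simp add: unitary_op_def)

lemma unitary_nsq: "unitary_op d F \<Longrightarrow> nsq d (F \<psi>) = nsq d \<psi>"
  using unitary_ip[of d F \<psi> \<psi>] by (simp add: ip_self)

text \<open>The difference of the two arguments has norm 0, hence so has its image. This makes the
  arbitrary values at labels from \<open>d\<close> on harmless.\<close>

lemma unitary_local:
  assumes "unitary_op d F" "\<And>s. s < d \<Longrightarrow> \<psi> s = \<phi> s" "s < d"
  shows "F \<psi> s = F \<phi> s"
proof -
  let ?e = "\<lambda>s. \<psi> s - \<phi> s"
  have "nsq d (F ?e) = nsq d ?e" by (rule unitary_nsq[OF assms(1)])
  also have "\<dots> = 0" using assms(2) by (simp add: nsq_def)
  finally have "F ?e s = 0" by (rule nsq_eq_0) fact
  then show ?thesis using linear_diff[OF unitary_linear[OF assms(1)], of \<psi> \<phi>] by (simp add: fun_eq_iff)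
qed

lemma unitary_id: "unitary_op d (\<lambda>\<psi>. \<psi>)"
  by (simp add: unitary_op_def linear_op_def)

lemma unitary_comp: "unitary_op d F \<Longrightarrow> unitary_op d G \<Longrightarrow> unitary_op d (\<lambda>\<psi>. F (G \<psi>))"
  by (simp add: unitary_op_def linear_op_def)

lemma unitary_diag:
  assumes "\<And>s. s < d \<Longrightarrow> cmod (c s) = 1"
  shows "unitary_op d (\<lambda>\<psi> s. c s * \<psi> s)"
proof -
  have "cnj (c s) * c s = 1" if "s < d" for s
    using assms[OF that] by (simp add: complex_norm_square[symmetric] mult.commute)
  then have *: "cnj (c s * \<psi> s) * (c s * \<phi> s) = cnj (\<psi> s) * \<phi> s" if "s < d" for s \<psi> \<phi>
  proof -
    have "cnj (c s * \<psi> s) * (c s * \<phi> s) = (cnj (c s) * c s) * (cnj (\<psi> s) * \<phi> s)" by simp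
    then show ?thesis using \<open>\<And>s. s < d \<Longrightarrow> cnj (c s) * c s = 1\<close>[OF that] by simp
  qed
  have "ip d (\<lambda>s. c s * \<psi> s) (\<lambda>s. c s * \<phi> s) = ip d \<psi> \<phi>" for \<psi> \<phi>
    unfolding ip_def by (intro sum.cong refl) (simp only: lessThan_iff *)
  then show ?thesis by (simp add: unitary_op_def linear_op_def algebra_simps)
qed

section \<open>Operators on a pair of registers\<close>

lemma sum_div_mod:
  fixes f :: "nat \<Rightarrow> 'a :: comm_monoid_add"
  shows "(\<Sum>k<W * N. f k) = (\<Sum>w<W. \<Sum>e<N. f (w * N + e))"
proof -
  have "(\<Sum>k<W * N. f k) = (\<Sum>w<W. sum f {w * N..<w * N + N})"
    by (rule sum.nat_group[symmetric])
  also have "\<dots> = (\<Sum>w<W. \<Sum>e<N. f (w * N + e))"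
  proof (rule sum.cong[OF refl])
    fix w
    show "sum f {w * N..<w * N + N} = (\<Sum>e<N. f (w * N + e))"
      by (rule sum.reindex_bij_witness[of _ "\<lambda>e. w * N + e" "\<lambda>k. k - w * N"]) auto
  qed
  finally show ?thesis .
qed

lemma div_mod_lt:
  fixes k W N :: nat
  assumes "k < W * N" shows "k div N < W" "k mod N < N"
  using assms less_mult_imp_div_less
  by (auto intro!: mod_less_divisor) (metis mult_0_right not_gr_zero not_less0)

text \<open>A label \<open>k\<close> encodes the pair of \<open>w = k div N\<close> and
  \<open>e = k mod N\<close>. This operator is block diagonal: \<open>w\<close> is a control that
  selects what happens to \<open>e\<close>.\<close>

definition ctl_op :: "nat \<Rightarrow> (nat \<Rightarrow> (nat \<Rightarrow> complex) \<Rightarrow> nat \<Rightarrow> complex) \<Rightarrow> (nat \<Rightarrow> complex) \<Rightarrow> nat \<Rightarrow> complex"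
  where "ctl_op N R \<psi> k = R (k div N) (\<lambda>e. \<psi> (k div N * N + e)) (k mod N)"

definition lift_op :: "nat \<Rightarrow> ((nat \<Rightarrow> complex) \<Rightarrow> nat \<Rightarrow> complex) \<Rightarrow> (nat \<Rightarrow> complex) \<Rightarrow> nat \<Rightarrow> complex"
  where "lift_op N F \<psi> k = F (\<lambda>w. \<psi> (w * N + k mod N)) (k div N)"

lemma unitary_ctl:
  assumes "\<And>w. unitary_op N (R w)"
  shows "unitary_op (W * N) (ctl_op N R)"
proof -
  have lin: "linear_op (ctl_op N R)"
    using linear_add[OF unitary_linear[OF assms]] linear_scale[OF unitary_linear[OF assms]]
    by (auto simp: linear_op_def ctl_op_def)
  have "ip (W * N) (ctl_op N R \<psi>) (ctl_op N R \<phi>) = ip (W * N) \<psi> \<phi>" for \<psi> \<phi>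
  proof -
    have "ip (W * N) (ctl_op N R \<psi>) (ctl_op N R \<phi>) =
        (\<Sum>w<W. ip N (R w (\<lambda>e. \<psi> (w * N + e))) (R w (\<lambda>e. \<phi> (w * N + e))))"
      unfolding ip_def sum_div_mod ctl_op_def by (intro sum.cong refl) auto
    also have "\<dots> = ip (W * N) \<psi> \<phi>"
      unfolding unitary_ip[OF assms] by (simp add: ip_def sum_div_mod)
    finally show ?thesis .
  qed
  with lin show ?thesis by (simp add: unitary_op_def)
qed

lemma unitary_lift:
  assumes "unitary_op W F"
  shows "unitary_op (W * N) (lift_op N F)"
proof -
  have lin: "linear_op (lift_op N F)"
    using linear_add[OF unitary_linear[OF assms]] linear_scale[OF unitary_linear[OF assms]]
    by (auto simp: linear_op_def lift_op_def)
  have "ip (W * N) (lift_op N F \<psi>) (lift_op N F \<phi>) = ip (W * N) \<psi> \<phi>" for \<psi> \<phi>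
  proof -
    have "ip (W * N) (lift_op N F \<psi>) (lift_op N F \<phi>) =
        (\<Sum>e<N. ip W (F (\<lambda>w. \<psi> (w * N + e))) (F (\<lambda>w. \<phi> (w * N + e))))"
      unfolding ip_def sum_div_mod lift_op_def by (subst sum.swap) (intro sum.cong refl, auto)
    also have "\<dots> = (\<Sum>e<N. ip W (\<lambda>w. \<psi> (w * N + e)) (\<lambda>w. \<phi> (w * N + e)))"
      unfolding unitary_ip[OF assms] ..
    also have "\<dots> = ip (W * N) \<psi> \<phi>" unfolding ip_def sum_div_mod by (rule sum.swap)
    finally show ?thesis .
  qed
  with lin show ?thesis by (simp add: unitary_op_def)
qed

lemma ctl_op_prod:
  assumes "\<And>w. unitary_op N (R w)" "\<And>w e. e < N \<Longrightarrow> R w (\<phi> w) e = \<chi> w e" "0 < N"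
  shows "ctl_op N R (\<lambda>k. \<psi> (k div N) * \<phi> (k div N) (k mod N)) = (\<lambda>k. \<psi> (k div N) * \<chi> (k div N) (k mod N))"
proof
  fix k
  have e: "k mod N < N" using assms(3) by simp
  have "R (k div N) (\<lambda>e. \<psi> ((k div N * N + e) div N) * \<phi> ((k div N * N + e) div N) ((k div N * N + e) mod N)) (k mod N)
      = R (k div N) (\<lambda>e. \<psi> (k div N) * \<phi> (k div N) e) (k mod N)"
    by (rule unitary_local[OF assms(1) _ e]) simp
  also have "\<dots> = \<psi> (k div N) * \<chi> (k div N) (k mod N)"
    by (subst linear_scale[OF unitary_linear[OF assms(1)]]) (simp add: assms(2)[OF e])
  finally show "ctl_op N R (\<lambda>k. \<psi> (k div N) * \<phi> (k div N) (k mod N)) k = \<psi> (k div N) * \<chi> (k div N) (k mod N)"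
    by (simp add: ctl_op_def)
qed

lemma lift_op_prod:
  assumes "linear_op F" "0 < N"
  shows "lift_op N F (\<lambda>k. \<psi> (k div N) * \<phi> (k mod N)) = (\<lambda>k. F \<psi> (k div N) * \<phi> (k mod N))"
proof
  fix k
  have "lift_op N F (\<lambda>k. \<psi> (k div N) * \<phi> (k mod N)) k = F (\<lambda>w. \<phi> (k mod N) * \<psi> w) (k div N)"
    using \<open>0 < N\<close> by (simp add: lift_op_def mult.commute)
  then show "lift_op N F (\<lambda>k. \<psi> (k div N) * \<phi> (k mod N)) k = F \<psi> (k div N) * \<phi> (k mod N)"
    using linear_scale[OF assms(1), of "\<phi> (k mod N)" \<psi>] by simp
qed

lemma delta_div_mod: "delta 0 k = delta 0 (k div N) * delta 0 (k mod N)"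
  using div_mult_mod_eq[of k N]
  by (metis delta_def div_0 mod_0 mult_0 mult_1 mult_zero_left mult_zero_right add_0)

lemma unitary_pad:
  assumes F: "unitary_op d F" and "d \<le> d'"
  shows "unitary_op d' (\<lambda>\<psi> s. if s < d then F \<psi> s else \<psi> s)"
proof -
  have lin: "linear_op (\<lambda>\<psi> s. if s < d then F \<psi> s else \<psi> s)"
    using linear_add[OF unitary_linear[OF F]] linear_scale[OF unitary_linear[OF F]]
    by (auto simp: linear_op_def)
  have split: "ip d' \<psi> \<phi> = ip d \<psi> \<phi> + (\<Sum>s=d..<d'. cnj (\<psi> s) * \<phi> s)" for \<psi> \<phi>
    unfolding ip_def using sum.atLeastLessThan_concat[of 0 d d' "\<lambda>s. cnj (\<psi> s) * \<phi> s"] \<open>d \<le> d'\<close>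
    by (simp add: atLeast0LessThan)
  have "ip d (\<lambda>s. if s < d then F \<psi> s else \<psi> s) (\<lambda>s. if s < d then F \<phi> s else \<phi> s) = ip d \<psi> \<phi>" for \<psi> \<phi>
    using unitary_ip[OF F, of \<psi> \<phi>] by (simp add: ip_def)
  then have "ip d' (\<lambda>s. if s < d then F \<psi> s else \<psi> s) (\<lambda>s. if s < d then F \<phi> s else \<phi> s) = ip d' \<psi> \<phi>" for \<psi> \<phi>
    by (simp add: split)
  with lin show ?thesis by (simp add: unitary_op_def)
qed

section \<open>Projectors and reflections\<close>

definition projector_onto_span :: "nat \<Rightarrow> (nat \<Rightarrow> complex) set \<Rightarrow> ((nat \<Rightarrow> complex) \<Rightarrow> nat \<Rightarrow> complex) \<Rightarrow> bool"
  where "projector_onto_span d V P \<longleftrightarrow>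
     linear_op P \<and> (\<forall>\<psi> \<phi>. ip d (P \<psi>) \<phi> = ip d \<psi> (P \<phi>)) \<and> (\<forall>\<psi>. P (P \<psi>) = P \<psi>) \<and>
     (\<forall>v\<in>V. \<forall>s<d. P v s = v s) \<and> (\<forall>u. (\<forall>v\<in>V. ip d v u = 0) \<longrightarrow> P u = (\<lambda>_. 0))"

text \<open>Gram-Schmidt, one vector at a time: \<open>e\<close> is the part of the new vector
  orthogonal to the previous span, and the projector onto the line of \<open>e\<close> is
  added.\<close>

lemma projector_exists:
  assumes "finite V"
  shows "\<exists>P. projector_onto_span d V P"
  using assms
proof (induction V rule: finite_induct)
  case empty
  show ?case by (rule exI[of _ "\<lambda>_ _. 0"]) (auto simp: projector_onto_span_def linear_op_def ip_def)
next
  case (insert v V)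
  from insert.IH obtain P where "projector_onto_span d V P" ..
  then have P: "linear_op P" "\<And>\<psi> \<phi>. ip d (P \<psi>) \<phi> = ip d \<psi> (P \<phi>)"
    and PP: "\<And>\<psi>. P (P \<psi>) = P \<psi>"
    and PV: "\<And>v s. v \<in> V \<Longrightarrow> s < d \<Longrightarrow> P v s = v s"
    and PO: "\<And>u. \<forall>v\<in>V. ip d v u = 0 \<Longrightarrow> P u = (\<lambda>_. 0)"
    by (auto simp: projector_onto_span_def)
  define e where "e = (\<lambda>s. v s - P v s)"
  have Pe: "P e = (\<lambda>_. 0)" unfolding e_def by (simp add: linear_diff[OF P(1)] PP)
  have eP: "ip d e (P \<psi>) = 0" for \<psi> using P(2)[of e \<psi>] by (simp add: Pe ip_def)
  define c where "c = ip d e e"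
  have cc: "cnj c = c" unfolding c_def by (rule cnj_ip)
  have ev: "ip d e v = c"
  proof -
    have "ip d e v = ip d e (\<lambda>s. e s + P v s)" by (simp add: e_def)
    then show ?thesis by (simp add: ip_simps eP c_def)
  qed
  have c0: "e s = 0" if "c = 0" "s < d" for s
    using that nsq_eq_0[of d e s] by (simp add: c_def ip_self)
  \<comment> \<open>If \<open>v\<close> already lies in the span, then \<open>c = 0\<close>, and
    division by zero yields 0, so that \<open>Q\<close> is \<open>P\<close>.\<close>
  define Q where "Q = (\<lambda>\<psi> s. P \<psi> s + (ip d e \<psi> / c) * e s)"
  have eQ: "ip d e (Q \<psi>) = ip d e \<psi>" for \<psi>
  proof (cases "c = 0")
    case True
    then have "ip d e \<phi> = 0" for \<phi> using c0 by (simp add: ip_def)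
    then show ?thesis by simp
  next
    case False
    then show ?thesis unfolding Q_def ip_simps eP c_def[symmetric] by simp
  qed
  have "linear_op Q"
    unfolding linear_op_def Q_def linear_add[OF P(1)] linear_scale[OF P(1)] ip_simps
    by (auto simp: algebra_simps add_divide_distrib)
  moreover have "ip d (Q \<psi>) \<phi> = ip d \<psi> (Q \<phi>)" for \<psi> \<phi>
    unfolding Q_def ip_simps P(2) using cc cnj_ip[of d e \<psi>] by (simp add: ac_simps)
  moreover have "Q (Q \<psi>) = Q \<psi>" for \<psi>
  proof -
    have "P (Q \<psi>) = P \<psi>"
      unfolding Q_def linear_add[OF P(1)] linear_scale[OF P(1)] by (simp add: PP Pe)
    moreover have "Q \<phi> = (\<lambda>s. P \<phi> s + (ip d e \<phi> / c) * e s)" for \<phi> by (simp only: Q_def)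
    ultimately show ?thesis using eQ[of \<psi>] by simp
  qed
  moreover have "Q v s = v s" if "s < d" for s
  proof (cases "c = 0")
    case True
    then show ?thesis using c0[OF True that] by (simp add: Q_def e_def)
  next
    case False
    then show ?thesis by (simp add: Q_def ev) (simp add: e_def)
  qed
  moreover have "Q w s = w s" if "w \<in> V" "s < d" for w s
  proof -
    have "ip d e w = ip d e (P w)" by (rule ip_cong) (simp_all add: PV[OF that(1)])
    then show ?thesis using PV[OF that] by (simp add: Q_def eP)
  qed
  moreover have "Q u = (\<lambda>_. 0)" if "\<forall>w\<in>insert v V. ip d w u = 0" for u
  proof -
    have Pu: "P u = (\<lambda>_. 0)" using PO that by blast
    have "ip d e u = ip d v u - ip d (P v) u" by (simp add: e_def ip_simps)
    also have "\<dots> = 0" using that P(2)[of v u] by (simp add: Pu ip_def)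
    finally show ?thesis by (simp add: Q_def Pu)
  qed
  ultimately have "projector_onto_span d (insert v V) Q" unfolding projector_onto_span_def by blast
  then show ?case by (rule exI[of _ Q])
qed

lemma reflection_exists:
  assumes "finite V"
  obtains R where "unitary_op d R"
    "\<And>v s. v \<in> V \<Longrightarrow> s < d \<Longrightarrow> R v s = v s"
    "\<And>u s. \<forall>v\<in>V. ip d v u = 0 \<Longrightarrow> R u s = - u s"
proof -
  from projector_exists[OF assms] obtain P where "projector_onto_span d V P" ..
  then have P: "linear_op P" "\<And>\<psi> \<phi>. ip d (P \<psi>) \<phi> = ip d \<psi> (P \<phi>)"
    and PP: "\<And>\<psi>. P (P \<psi>) = P \<psi>"
    and PV: "\<And>v s. v \<in> V \<Longrightarrow> s < d \<Longrightarrow> P v s = v s"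
    and PO: "\<And>u. \<forall>v\<in>V. ip d v u = 0 \<Longrightarrow> P u = (\<lambda>_. 0)"
    by (auto simp: projector_onto_span_def)
  define R where "R = (\<lambda>\<psi> s. 2 * P \<psi> s - \<psi> s)"
  have "linear_op R"
    unfolding linear_op_def R_def linear_add[OF P(1)] linear_scale[OF P(1)]
    by (auto simp: algebra_simps)
  moreover have "ip d (R \<psi>) (R \<phi>) = ip d \<psi> \<phi>" for \<psi> \<phi>
    unfolding R_def ip_simps P(2) PP by simp
  ultimately have "unitary_op d R" by (simp add: unitary_op_def)
  moreover have "R v s = v s" if "v \<in> V" "s < d" for v s using PV[OF that] by (simp add: R_def)
  moreover have "R u s = - u s" if "\<forall>v\<in>V. ip d v u = 0" for u s
    using PO[OF that] by (simp add: R_def)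
  ultimately show ?thesis using that by blast
qed

text \<open>The reflection about \<open>e + u\<close> does this: equal norms and a real inner
  product make \<open>e - u\<close> orthogonal to \<open>e + u\<close>, so it is negated. Such a
  swap both prepares a state and undoes the preparation.\<close>

lemma swap_exists:
  assumes "ip d e e = ip d u u" "ip d e u = ip d u e"
  obtains R where "unitary_op d R" "\<And>s. s < d \<Longrightarrow> R e s = u s" "\<And>s. s < d \<Longrightarrow> R u s = e s"
proof -
  obtain R where R: "unitary_op d R"
    and p: "\<And>v s. v \<in> {\<lambda>s. e s + u s} \<Longrightarrow> s < d \<Longrightarrow> R v s = v s"
    and o: "\<And>w s. \<forall>v\<in>{\<lambda>s. e s + u s}. ip d v w = 0 \<Longrightarrow> R w s = - w s"
    by (rule reflection_exists[of "{\<lambda>s. e s + u s}" d]) auto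
  have m: "R (\<lambda>s. e s - u s) s = u s - e s" for s
    using o[of "\<lambda>s. e s - u s"] assms by (simp add: ip_simps)
  have L: "R (\<lambda>s. e s + u s) s = R e s + R u s" "R (\<lambda>s. e s - u s) s = R e s - R u s" for s
    using linear_add[OF unitary_linear[OF R]] linear_diff[OF unitary_linear[OF R]] by auto
  have A: "R e s + R u s = e s + u s" "R e s - R u s = u s - e s" if "s < d" for s
    using p[OF _ that, of "\<lambda>s. e s + u s"] m[of s] L[of s] by auto
  have "R e s = u s" if "s < d" for s
  proof -
    have "2 * R e s = (R e s + R u s) + (R e s - R u s)" by simp
    also have "\<dots> = 2 * u s" unfolding A[OF that] by simp
    finally show ?thesis by simp
  qed
  moreover from this have "R u s = e s" if "s < d" for s using A(1)[OF that] that by simp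
  ultimately show ?thesis using that R by blast
qed

section \<open>Composable query algorithms\<close>

definition phase :: "bool list \<Rightarrow> nat option \<Rightarrow> complex" where
  "phase x p = (case p of None \<Rightarrow> 1 | Some i \<Rightarrow> if x ! i then - 1 else 1)"

lemma phase_simps [simp]: "phase x None = 1" "phase x (Some i) = (if x ! i then - 1 else 1)"
  by (simp_all add: phase_def)

lemma cmod_phase: "cmod (phase x p) = 1"
  by (cases p) auto

text \<open>A simplified query model without index register and answer qubit: in round \<open>t\<close>, the basis state
  with label \<open>s\<close> queries bit \<open>q t s\<close>, or nothing, and receives the answer as a sign.\<close>

primrec phase_state ::
  "(nat \<Rightarrow> (nat \<Rightarrow> complex) \<Rightarrow> nat \<Rightarrow> complex) \<Rightarrow> (nat \<Rightarrow> nat \<Rightarrow> nat option) \<Rightarrow> bool list \<Rightarrow> nat \<Rightarrow> nat \<Rightarrow> complex"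
where
  "phase_state F q x 0 = F 0 (delta 0)"
| "phase_state F q x (Suc t) = F (Suc t) (\<lambda>s. phase x (q t s) * phase_state F q x t s)"

definition valid_gates ::
  "nat \<Rightarrow> nat \<Rightarrow> (nat \<Rightarrow> (nat \<Rightarrow> complex) \<Rightarrow> nat \<Rightarrow> complex) \<Rightarrow> (nat \<Rightarrow> nat \<Rightarrow> nat option) \<Rightarrow> bool" where
  "valid_gates n W F q \<longleftrightarrow> (\<forall>t. unitary_op W (F t)) \<and> (\<forall>t s. set_option (q t s) \<subseteq> {..<n})"

definition prepares ::
  "nat \<Rightarrow> nat \<Rightarrow> nat \<Rightarrow> (nat \<Rightarrow> (nat \<Rightarrow> complex) \<Rightarrow> nat \<Rightarrow> complex) \<Rightarrow> (nat \<Rightarrow> nat \<Rightarrow> nat option) \<Rightarrow>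
     (bool list \<Rightarrow> nat \<Rightarrow> complex) \<Rightarrow> bool" where
  "prepares n W T F q \<Psi> \<longleftrightarrow> valid_gates n W F q \<and>
     (\<forall>x s. length x = n \<longrightarrow> s < W \<longrightarrow> \<Psi> x s = phase_state F q x T s)"

text \<open>Hiding the gates behind an existential allows algorithms to be built from closure
  properties alone.\<close>

definition reach :: "nat \<Rightarrow> nat \<Rightarrow> nat \<Rightarrow> (bool list \<Rightarrow> nat \<Rightarrow> complex) \<Rightarrow> bool" where
  "reach n W T \<Psi> \<longleftrightarrow> (\<exists>F q. prepares n W T F q \<Psi>)"

lemma preparesD:
  assumes "prepares n W T F q \<Psi>"
  shows "valid_gates n W F q" "length x = n \<Longrightarrow> s < W \<Longrightarrow> \<Psi> x s = phase_state F q x T s"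
  using assms by (simp_all add: prepares_def)

lemma reachI:
  assumes "valid_gates n W F q"
    "\<And>x s. length x = n \<Longrightarrow> s < W \<Longrightarrow> \<Psi> x s = phase_state F q x T s"
  shows "reach n W T \<Psi>"
  unfolding reach_def by (intro exI[of _ F] exI[of _ q]) (simp add: prepares_def assms)

lemma phase_state_cong:
  "(\<And>t. t \<le> T \<Longrightarrow> F t = F' t) \<Longrightarrow> (\<And>t. t < T \<Longrightarrow> q t = q' t) \<Longrightarrow> phase_state F q x T = phase_state F' q' x T"
  by (induction T) auto

lemma nsq_phase: "nsq W (\<lambda>s. phase x (p s) * \<psi> s) = nsq W \<psi>"
  by (simp add: nsq_def norm_mult cmod_phase)

lemma nsq_delta: "a < d \<Longrightarrow> nsq d (delta a) = 1"
  unfolding nsq_def delta_def by (simp add: if_distrib [of cmod] if_distrib[of "\<lambda>c. c\<^sup>2"] cong: if_cong)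

lemma reach_cong:
  assumes "reach n W T \<Psi>" "\<And>x s. length x = n \<Longrightarrow> s < W \<Longrightarrow> \<Psi>' x s = \<Psi> x s"
  shows "reach n W T \<Psi>'"
  using assms by (auto simp: reach_def prepares_def)

lemma reach_delta: "reach n W 0 (\<lambda>x. delta 0)"
  by (rule reachI[of n W "\<lambda>t \<psi>. \<psi>" "\<lambda>t s. None"]) (auto simp: valid_gates_def unitary_id)

text \<open>The new gate is merged into gate \<open>T\<close>; input-independent operations cost no
  query.\<close>

lemma reach_gate:
  assumes "reach n W T \<Psi>" "unitary_op W G"
  shows "reach n W T (\<lambda>x. G (\<Psi> x))"
proof -
  obtain F q where "prepares n W T F q \<Psi>" using assms(1) by (auto simp: reach_def)
  note v = preparesD(1)[OF this] and \<Psi> = preparesD(2)[OF this]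
  define F' where "F' = F(T := \<lambda>\<psi>. G (F T \<psi>))"
  have st: "phase_state F' q x T = G (phase_state F q x T)" for x
  proof (cases T)
    case 0 then show ?thesis by (simp add: F'_def)
  next
    case (Suc t)
    have "phase_state F' q x t = phase_state F q x t"
      by (rule phase_state_cong) (auto simp: F'_def Suc)
    then show ?thesis by (simp add: Suc F'_def)
  qed
  have "valid_gates n W F' q"
    using v assms(2) by (auto simp: valid_gates_def F'_def intro: unitary_comp)
  moreover have "G (\<Psi> x) s = phase_state F' q x T s" if "length x = n" "s < W" for x s
    unfolding st by (rule unitary_local[OF assms(2)]) (use \<Psi> that in auto)
  ultimately show ?thesis by (rule reachI)
qed

lemma reach_query:
  assumes "reach n W T \<Psi>" "\<And>s. set_option (p s) \<subseteq> {..<n}"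
  shows "reach n W (Suc T) (\<lambda>x s. phase x (p s) * \<Psi> x s)"
proof -
  obtain F q where "prepares n W T F q \<Psi>" using assms(1) by (auto simp: reach_def)
  note v = preparesD(1)[OF this] and \<Psi> = preparesD(2)[OF this]
  define F' where "F' = F(Suc T := \<lambda>\<psi>. \<psi>)"
  define q' where "q' = q(T := p)"
  have "phase_state F' q' x T = phase_state F q x T" for x
    by (rule phase_state_cong) (auto simp: F'_def q'_def)
  then have "phase_state F' q' x (Suc T) = (\<lambda>s. phase x (p s) * phase_state F q x T s)" for x
    by (simp add: F'_def q'_def)
  moreover have "valid_gates n W F' q'"
    using v assms(2) unfolding valid_gates_def F'_def q'_def by (auto simp: unitary_id)
  ultimately show ?thesis by (intro reachI[of n W F' q']) (simp_all add: \<Psi>)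
qed

lemma reach_mono_T:
  assumes "reach n W T \<Psi>" "T \<le> T'"
  shows "reach n W T' \<Psi>"
  using assms(2,1)
proof (induction rule: dec_induct)
  case (step t)
  then show ?case using reach_query[of n W t \<Psi> "\<lambda>_. None"] by simp
qed simp

lemma reach_norm:
  assumes "reach n W T \<Psi>" "length x = n" "0 < W"
  shows "nsq W (\<Psi> x) = 1"
proof -
  obtain F q where "prepares n W T F q \<Psi>" using assms(1) by (auto simp: reach_def)
  note v = preparesD(1)[OF this] and \<Psi> = preparesD(2)[OF this]
  have "nsq W (\<Psi> x) = nsq W (phase_state F q x T)"
    by (rule nsq_cong) (use \<Psi> assms(2) in auto)
  moreover have "nsq W (phase_state F q x t) = 1" for t
    by (induction t) (use v assms(3) in \<open>auto simp: valid_gates_def unitary_nsq nsq_delta nsq_phase\<close>)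
  ultimately show ?thesis by simp
qed

lemma reach_pad:
  assumes "reach n W T \<Psi>" "0 < W" "W \<le> W'"
  shows "reach n W' T (\<lambda>x s. if s < W then \<Psi> x s else 0)"
proof -
  obtain F q where "prepares n W T F q \<Psi>" using assms(1) by (auto simp: reach_def)
  note v = preparesD(1)[OF this] and \<Psi> = preparesD(2)[OF this]
  define F' where "F' = (\<lambda>t \<psi> s. if s < W then F t \<psi> s else \<psi> s)"
  have U: "unitary_op W (F t)" for t using v by (simp add: valid_gates_def)
  have st: "phase_state F' q x t s = (if s < W then phase_state F q x t s else 0)" for x t s
  proof (induction t arbitrary: s)
    case 0
    then show ?case using assms(2) by (simp add: F'_def delta_def)
  next
    case (Suc t)
    show ?case
    proof (cases "s < W")
      case True
      have "F (Suc t) (\<lambda>s. phase x (q t s) * phase_state F' q x t s) s =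
          F (Suc t) (\<lambda>s. phase x (q t s) * phase_state F q x t s) s"
        by (rule unitary_local[OF U]) (use Suc True in auto)
      then show ?thesis using True by (simp add: F'_def)
    next
      case False
      then show ?thesis using Suc by (simp add: F'_def)
    qed
  qed
  have "valid_gates n W' F' q"
    using v assms(3) unfolding valid_gates_def F'_def by (auto intro: unitary_pad)
  moreover have "(if s < W then \<Psi> x s else 0) = phase_state F' q x T s" if "length x = n" for x s
    using st \<Psi> that by simp
  ultimately show ?thesis by (rule reachI)
qed

lemma reach_lift:
  assumes "reach n W T \<Psi>" "0 < N"
  shows "reach n (W * N) T (\<lambda>x k. \<Psi> x (k div N) * delta 0 (k mod N))"
proof -
  obtain F q where "prepares n W T F q \<Psi>" using assms(1) by (auto simp: reach_def)
  note v = preparesD(1)[OF this] and \<Psi> = preparesD(2)[OF this]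
  define F' where "F' = (\<lambda>t. lift_op N (F t))"
  define q' where "q' = (\<lambda>t k. q t (k div N))"
  have "linear_op (F t)" for t using v unitary_linear by (auto simp: valid_gates_def)
  note F'_prod = lift_op_prod[OF this assms(2)]
  have st: "phase_state F' q' x t = (\<lambda>k. phase_state F q x t (k div N) * delta 0 (k mod N))" for x t
  proof (induction t)
    case 0
    have "delta 0 = (\<lambda>k. delta 0 (k div N) * delta 0 (k mod N))" by (rule ext) (rule delta_div_mod)
    then show ?case using F'_prod[of 0 "delta 0" "delta 0"] by (simp add: F'_def)
  next
    case (Suc t)
    then show ?case
      using F'_prod[of "Suc t" "\<lambda>s. phase x (q t s) * phase_state F q x t s" "delta 0"]
      by (simp add: F'_def q'_def mult.assoc)
  qed
  have "valid_gates n (W * N) F' q'"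
    using v unfolding valid_gates_def F'_def q'_def by (auto intro: unitary_lift)
  moreover have "\<Psi> x (k div N) * delta 0 (k mod N) = phase_state F' q' x T k"
    if "length x = n" "k < W * N" for x k
    using st \<Psi> that div_mod_lt(1)[OF that(2)] by simp
  ultimately show ?thesis by (rule reachI)
qed

text \<open>Sequential composition: the final label \<open>w\<close> of the first algorithm is kept
  as a control that selects the second one. All choices run in superposition on the same rounds, so
  the query numbers add instead of multiplying with the number of labels.\<close>

lemma reach_prod:
  assumes "reach n W T \<Psi>" "\<And>w. reach n N T' (\<Phi> w)" "0 < N"
  shows "reach n (W * N) (T + T') (\<lambda>x k. \<Psi> x (k div N) * \<Phi> (k div N) x (k mod N))"
proof -
  have "\<forall>w. \<exists>F q. prepares n N T' F q (\<Phi> w)" using assms(2) unfolding reach_def by blast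
  then obtain F where "\<forall>w. \<exists>q. prepares n N T' (F w) q (\<Phi> w)" by (rule choice[THEN exE])
  then obtain q where "\<forall>w. prepares n N T' (F w) (q w) (\<Phi> w)" by (rule choice[THEN exE])
  note v = preparesD(1)[OF this[rule_format]] and \<Phi> = preparesD(2)[OF this[rule_format]]
  have U: "unitary_op N (F w t)" for w t using v by (simp add: valid_gates_def)
  let ?st = "\<lambda>w. phase_state (F w) (q w)"
  have main: "reach n (W * N) (T + t) (\<lambda>x k. \<Psi> x (k div N) * ?st (k div N) x t (k mod N))" for t
  proof (induction t)
    case 0
    have "reach n (W * N) T (\<lambda>x. ctl_op N (\<lambda>w. F w 0) (\<lambda>k. \<Psi> x (k div N) * delta 0 (k mod N)))"
      by (rule reach_gate[OF reach_lift[OF assms(1,3)] unitary_ctl]) (rule U)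
    moreover have "ctl_op N (\<lambda>w. F w 0) (\<lambda>k. \<Psi> x (k div N) * delta 0 (k mod N)) =
        (\<lambda>k. \<Psi> x (k div N) * ?st (k div N) x 0 (k mod N))" for x
      by (rule ctl_op_prod[where \<phi> = "\<lambda>_. delta 0" and \<chi> = "\<lambda>w. ?st w x 0", OF U _ assms(3)]) simp
    ultimately show ?case by simp
  next
    case (Suc t)
    let ?\<phi> = "\<lambda>x w e. phase x (q w t e) * ?st w x t e"
    have "reach n (W * N) (Suc (T + t)) (\<lambda>x k. phase x (q (k div N) t (k mod N)) *
        (\<Psi> x (k div N) * ?st (k div N) x t (k mod N)))"
      by (rule reach_query[OF Suc]) (use v in \<open>auto simp: valid_gates_def\<close>)
    then have "reach n (W * N) (Suc (T + t)) (\<lambda>x k. \<Psi> x (k div N) * ?\<phi> x (k div N) (k mod N))"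
      by (rule reach_cong) simp
    then have "reach n (W * N) (Suc (T + t)) (\<lambda>x. ctl_op N (\<lambda>w. F w (Suc t))
        (\<lambda>k. \<Psi> x (k div N) * ?\<phi> x (k div N) (k mod N)))"
      by (rule reach_gate[OF _ unitary_ctl]) (rule U)
    moreover have "ctl_op N (\<lambda>w. F w (Suc t)) (\<lambda>k. \<Psi> x (k div N) * ?\<phi> x (k div N) (k mod N)) =
        (\<lambda>k. \<Psi> x (k div N) * ?st (k div N) x (Suc t) (k mod N))" for x
      by (rule ctl_op_prod[where \<phi> = "?\<phi> x" and \<chi> = "\<lambda>w. ?st w x (Suc t)", OF U _ assms(3)]) simp
    ultimately show ?case by simp
  qed
  show ?thesis
    by (rule reach_cong[OF main[of T']]) (use \<Phi> div_mod_lt(2) in auto)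
qed

section \<open>Output distributions and their composition\<close>

definition outputs :: "nat \<Rightarrow> nat \<Rightarrow> nat \<Rightarrow> (bool list \<Rightarrow> nat \<Rightarrow> complex) \<Rightarrow> (nat \<Rightarrow> 'o) \<Rightarrow> (bool list \<Rightarrow> 'o \<Rightarrow> real) \<Rightarrow> bool"
where
  "outputs n W T \<Psi> out p \<longleftrightarrow> 0 < W \<and> reach n W T \<Psi> \<and>
     (\<forall>x v. length x = n \<longrightarrow> p x v = (\<Sum>s | s < W \<and> out s = v. (cmod (\<Psi> x s))\<^sup>2))"

text \<open>Algorithms are seen only through their outcome probabilities. With return, bind and
  reading of a bit, classical control flow between quantum subroutines becomes arithmetic with
  distributions.\<close>

definition implementable :: "nat \<Rightarrow> nat \<Rightarrow> (bool list \<Rightarrow> 'o \<Rightarrow> real) \<Rightarrow> bool" where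
  "implementable n T p \<longleftrightarrow> (\<exists>W \<Psi> out. outputs n W T \<Psi> out p)"

lemma outputsD:
  assumes "outputs n W T \<Psi> out p"
  shows "0 < W" "reach n W T \<Psi>"
    "length x = n \<Longrightarrow> p x v = (\<Sum>s | s < W \<and> out s = v. (cmod (\<Psi> x s))\<^sup>2)"
  using assms by (simp_all add: outputs_def)

lemma implementableI:
  assumes "0 < W" "reach n W T \<Psi>"
    "\<And>x v. length x = n \<Longrightarrow> p x v = (\<Sum>s | s < W \<and> out s = v. (cmod (\<Psi> x s))\<^sup>2)"
  shows "implementable n T p"
  unfolding implementable_def
  by (intro exI[of _ W] exI[of _ \<Psi>] exI[of _ out]) (simp add: outputs_def assms)

lemma implementable_mono_T: "implementable n T p \<Longrightarrow> T \<le> T' \<Longrightarrow> implementable n T' p"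
  unfolding implementable_def outputs_def using reach_mono_T by blast

lemma implementable_nonneg: "implementable n T p \<Longrightarrow> length x = n \<Longrightarrow> p x v \<ge> 0"
  by (auto simp: implementable_def outputs_def sum_nonneg)

lemma implementable_total:
  assumes "implementable n T p" "length x = n" "finite K" "\<And>k. k \<notin> K \<Longrightarrow> p x k = 0"
  shows "(\<Sum>k\<in>K. p x k) = 1"
proof -
  obtain W \<Psi> out where "outputs n W T \<Psi> out p" using assms(1) unfolding implementable_def by blast
  note W = outputsD(1,2)[OF this] and p = outputsD(3)[OF this]
  have "(\<Sum>k\<in>K. p x k) = (\<Sum>k\<in>K \<union> out ` {..<W}. p x k)"
    using assms(3,4) by (intro sum.mono_neutral_left) auto
  also have "\<dots> = (\<Sum>k\<in>K \<union> out ` {..<W}. \<Sum>s\<in>{s \<in> {..<W}. out s = k}. (cmod (\<Psi> x s))\<^sup>2)"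
    by (simp add: p[OF assms(2)])
  also have "\<dots> = nsq W (\<Psi> x)"
    unfolding nsq_def by (rule sum.group) (use assms(3) in auto)
  finally show ?thesis using reach_norm[OF W(2) assms(2) W(1)] by simp
qed

lemma implementable_return: "implementable n T (\<lambda>x o'. if o' = c then 1 else 0)"
proof -
  have "implementable n 0 (\<lambda>x o'. if o' = c then 1 else 0)"
  proof (rule implementableI[of 1 n 0 "\<lambda>x. delta 0" _ "\<lambda>_. c"])
    show "(if v = c then 1 else 0) = (\<Sum>s | s < 1 \<and> c = v. (cmod (delta 0 s))\<^sup>2)" for v
      by (auto simp: delta_def)
  qed (auto intro: reach_delta)
  then show ?thesis by (rule implementable_mono_T) simp
qed

text \<open>Deferred measurement: the label that determines \<open>k\<close> is never altered
  afterwards, so different labels do not interfere and the final distribution is the classical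
  mixture of the continuations.\<close>

lemma implementable_bind:
  fixes p :: "bool list \<Rightarrow> 'k \<Rightarrow> real" and r :: "'k \<Rightarrow> bool list \<Rightarrow> 'o \<Rightarrow> real"
  assumes p: "implementable n T p" and r: "\<And>k. implementable n T' (r k)"
    and K: "finite K" "\<And>x k. length x = n \<Longrightarrow> k \<notin> K \<Longrightarrow> p x k = 0"
  shows "implementable n (T + T') (\<lambda>x v. \<Sum>k\<in>K. p x k * r k x v)"
proof -
  obtain W \<Psi> out where "outputs n W T \<Psi> out p" using p unfolding implementable_def by blast
  note W = outputsD(1,2)[OF this] and pe = outputsD(3)[OF this]
  have "\<forall>k. \<exists>W \<Psi> out. outputs n W T' \<Psi> out (r k)" using r unfolding implementable_def by blast
  then obtain V where "\<forall>k. \<exists>\<Psi> out. outputs n (V k) T' \<Psi> out (r k)" by (rule choice[THEN exE])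
  then obtain \<Phi> where "\<forall>k. \<exists>out. outputs n (V k) T' (\<Phi> k) out (r k)" by (rule choice[THEN exE])
  then obtain out' where "\<forall>k. outputs n (V k) T' (\<Phi> k) (out' k) (r k)" by (rule choice[THEN exE])
  note V = outputsD(1,2)[OF this[rule_format]] and re = outputsD(3)[OF this[rule_format]]
  \<comment> \<open>The continuations may have registers of different sizes; \<open>N\<close> is
    large enough for all that occur.\<close>
  define N where "N = Max ((\<lambda>w. V (out w)) ` {..<W})"
  have VN: "V (out w) \<le> N" if "w < W" for w unfolding N_def using that by (intro Max_ge) auto
  have N0: "0 < N" using VN[OF W(1)] V(1)[of "out 0"] by simp
  \<comment> \<open>Labels from \<open>W\<close> on never occur but need some state, since
    \<open>reach_prod\<close> asks for one at every \<open>w\<close>.\<close>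
  define \<Phi>' where "\<Phi>' = (\<lambda>w x s. if w < W then (if s < V (out w) then \<Phi> (out w) x s else 0) else delta 0 s)"
  have R: "reach n N T' (\<Phi>' w)" for w
  proof (cases "w < W")
    case True
    then show ?thesis using reach_pad[OF V(2,1) VN[OF True]] by (simp add: \<Phi>'_def)
  next
    case False
    then show ?thesis using reach_mono_T[OF reach_delta, of T' n N] by (simp add: \<Phi>'_def)
  qed
  define fin where "fin = (\<lambda>k. out' (out (k div N)) (k mod N))"
  show ?thesis
  proof (rule implementableI[where out = fin, OF _ reach_prod[OF W(2) R N0]])
    show "0 < W * N" using W(1) N0 by simp
    fix x :: "bool list" and v
    assume x: "length x = n"
    have fib: "(\<Sum>e<N. if out' (out w) e = v then (cmod (\<Phi>' w x e))\<^sup>2 else 0) = r (out w) x v" if "w < W" for w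
    proof -
      have "(\<Sum>e<N. if out' (out w) e = v then (cmod (\<Phi>' w x e))\<^sup>2 else 0) =
          (\<Sum>e<V (out w). if out' (out w) e = v then (cmod (\<Phi> (out w) x e))\<^sup>2 else 0)"
        using VN[OF that] that by (intro sum.mono_neutral_cong_right) (auto simp: \<Phi>'_def)
      also have "\<dots> = r (out w) x v"
        unfolding re[OF x] by (simp add: sum.inter_filter[symmetric])
      finally show ?thesis .
    qed
    have "(\<Sum>k | k < W * N \<and> fin k = v. (cmod (\<Psi> x (k div N) * \<Phi>' (k div N) x (k mod N)))\<^sup>2)
        = (\<Sum>k<W * N. if fin k = v then (cmod (\<Psi> x (k div N) * \<Phi>' (k div N) x (k mod N)))\<^sup>2 else 0)"
      using sum.inter_filter[of "{..<W * N}"] by simp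
    also have "\<dots> = (\<Sum>w<W. \<Sum>e<N. (cmod (\<Psi> x w))\<^sup>2 * (if out' (out w) e = v then (cmod (\<Phi>' w x e))\<^sup>2 else 0))"
      unfolding sum_div_mod by (intro sum.cong refl) (auto simp: fin_def norm_mult power_mult_distrib)
    also have "\<dots> = (\<Sum>w<W. (cmod (\<Psi> x w))\<^sup>2 * r (out w) x v)"
      unfolding sum_distrib_left[symmetric] by (intro sum.cong refl) (simp add: fib)
    also have "\<dots> = (\<Sum>k\<in>K \<union> out ` {..<W}. \<Sum>w\<in>{w \<in> {..<W}. out w = k}. (cmod (\<Psi> x w))\<^sup>2 * r (out w) x v)"
      by (rule sum.group[symmetric]) (use K(1) in auto)
    also have "\<dots> = (\<Sum>k\<in>K \<union> out ` {..<W}. p x k * r k x v)"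
      by (intro sum.cong refl) (simp add: pe[OF x] sum_distrib_right)
    also have "\<dots> = (\<Sum>k\<in>K. p x k * r k x v)"
      using K x by (intro sum.mono_neutral_right) auto
    finally show "(\<Sum>k\<in>K. p x k * r k x v) =
      (\<Sum>k | k < W * N \<and> fin k = v. (cmod (\<Psi> x (k div N) * \<Phi>' (k div N) x (k mod N)))\<^sup>2)" ..
  qed
qed

text \<open>A Hadamard gate on either side of a query that only label 1 makes: label 0, which
  queries nothing, is the reference that turns the sign into a visible bit.\<close>

lemma implementable_bit:
  assumes "i < n"
  shows "implementable n 1 (\<lambda>x b. if b = x ! i then 1 else 0)"
proof -
  define h :: complex where "h = of_real (1 / sqrt 2)"
  have h: "cnj h = h" "h * h = 1 / 2"
    unfolding h_def by (simp, simp flip: of_real_mult)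
  define H :: "(nat \<Rightarrow> complex) \<Rightarrow> nat \<Rightarrow> complex" where
    "H = (\<lambda>\<psi> s. h * (if s = 0 then \<psi> 0 + \<psi> 1 else \<psi> 0 - \<psi> 1))"
  have "ip 2 (H \<psi>) (H \<phi>) = ip 2 \<psi> \<phi>" for \<psi> \<phi>
  proof -
    have s2: "(\<Sum>s<2. f s) = f 0 + f 1" for f :: "nat \<Rightarrow> complex" by (simp add: numeral_2_eq_2)
    have "ip 2 (H \<psi>) (H \<phi>) =
        h * h * (cnj (\<psi> 0 + \<psi> 1) * (\<phi> 0 + \<phi> 1) + cnj (\<psi> 0 - \<psi> 1) * (\<phi> 0 - \<phi> 1))"
      unfolding ip_def s2 H_def complex_cnj_mult h(1) by (simp add: algebra_simps)
    also have "\<dots> = ip 2 \<psi> \<phi>" unfolding h ip_def s2 by (simp add: algebra_simps)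
    finally show ?thesis .
  qed
  moreover have "H (\<lambda>s. \<psi> s + \<phi> s) = (\<lambda>s. H \<psi> s + H \<phi> s)" for \<psi> \<phi>
    by (rule ext) (simp add: H_def ring_distribs)
  moreover have "H (\<lambda>s. c * \<psi> s) = (\<lambda>s. c * H \<psi> s)" for c \<psi>
    by (rule ext) (simp add: H_def ring_distribs mult.left_commute)
  ultimately have H: "unitary_op 2 H"
    by (simp add: unitary_op_def linear_op_def)
  define p :: "nat \<Rightarrow> nat option" where "p = (\<lambda>s. if s = 1 then Some i else None)"
  let ?\<Psi> = "\<lambda>x. H (\<lambda>s. phase x (p s) * H (delta 0) s)"
  have "reach n 2 (Suc 0) ?\<Psi>"
    by (rule reach_gate[OF reach_query[OF reach_gate[OF reach_delta H]] H]) (use assms in \<open>auto simp: p_def\<close>)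
  moreover have \<Psi>: "?\<Psi> x s = (if (s = 1) = (x ! i) then 1 else 0)" if "s < 2" for x s
  proof -
    have "?\<Psi> x s = h * h * (1 + (if s = 0 then 1 else - 1) * phase x (Some i))"
      by (cases "s = 0"; cases "x ! i") (simp_all add: H_def delta_def p_def ring_distribs)
    then show ?thesis using that unfolding h by (cases "s = 0"; cases "x ! i") simp_all
  qed
  have "(if v = x ! i then 1 else 0) = (\<Sum>s | s < 2 \<and> (s = 1) = v. (cmod (?\<Psi> x s))\<^sup>2)" for x v
  proof -
    have "{s::nat. s < 2 \<and> (s = 1) = v} = {if v then 1 else 0}" by auto
    then show ?thesis by (auto simp: \<Psi>)
  qed
  ultimately show ?thesis
    by (intro implementableI[of 2 n 1 ?\<Psi> _ "\<lambda>s. s = 1"]) simp_all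
qed

text \<open>The bits are read one after the other; \<open>g\<close> is arbitrary in the induction so
  that it can absorb the bits already known.\<close>

lemma implementable_read:
  assumes "set js \<subseteq> {..<n}"
  shows "implementable n (length js) (\<lambda>x v. if v = g (map ((!) x) js) then 1 else 0)"
  using assms
proof (induction js arbitrary: g)
  case Nil
  show ?case using implementable_return[of n 0 "g []"] by simp
next
  case (Cons j js)
  define r :: "bool \<Rightarrow> bool list \<Rightarrow> 'a \<Rightarrow> real"
    where "r = (\<lambda>b x v. if v = g (b # map ((!) x) js) then 1 else 0)"
  have "implementable n (length js) (r b)" for b
    using Cons.IH[of "\<lambda>bs. g (b # bs)"] Cons.prems by (simp add: r_def)
  then have "implementable n (1 + length js) (\<lambda>x v. \<Sum>b\<in>UNIV. (if b = x ! j then 1 else 0) * r b x v)"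
    using Cons.prems by (intro implementable_bind[of n 1 _ "length js" r UNIV] implementable_bit) auto
  moreover have "(\<Sum>b\<in>UNIV. (if b = x ! j then 1 else 0) * r b x v) =
      (if v = g (map ((!) x) (j # js)) then 1 else 0)" for x v
    by (cases "x ! j") (simp_all only: UNIV_bool r_def, simp_all)
  ultimately show ?case by simp
qed

section \<open>Translation into matrices and the standard query operator\<close>

definition op_mat :: "nat \<Rightarrow> ((nat \<Rightarrow> complex) \<Rightarrow> nat \<Rightarrow> complex) \<Rightarrow> complex mat" where
  "op_mat d F = mat d d (\<lambda>(r, c). F (delta c) r)"

lemma unitary_expand:
  assumes F: "unitary_op d F" and r: "r < d"
  shows "F \<psi> r = (\<Sum>c<d. F (delta c) r * \<psi> c)"
proof -
  have "F \<psi> r = F (\<lambda>s. \<Sum>c<d. \<psi> c * delta c s) r"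
    by (rule unitary_local[OF F _ r]) (simp add: delta_def if_distrib[of "\<lambda>z. _ * z"] cong: if_cong)
  also have "\<dots> = (\<Sum>c<d. F (\<lambda>s. \<psi> c * delta c s) r)"
    by (subst linear_sum[OF unitary_linear[OF F]]) simp
  also have "\<dots> = (\<Sum>c<d. F (delta c) r * \<psi> c)"
    by (subst linear_scale[OF unitary_linear[OF F]]) (simp add: mult.commute)
  finally show ?thesis .
qed

lemma op_mat_mult_vec:
  assumes "unitary_op d F"
  shows "op_mat d F *\<^sub>v vec d \<psi> = vec d (F \<psi>)"
proof (rule eq_vecI)
  fix r assume "r < dim_vec (vec d (F \<psi>))"
  then have r: "r < d" by simp
  then have "(op_mat d F *\<^sub>v vec d \<psi>) $ r = (\<Sum>c<d. F (delta c) r * \<psi> c)"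
    by (simp add: op_mat_def scalar_prod_def atLeast0LessThan)
  then show "(op_mat d F *\<^sub>v vec d \<psi>) $ r = vec d (F \<psi>) $ r"
    using r by (simp add: unitary_expand[OF assms r, of \<psi>])
qed (simp add: op_mat_def)

lemma unitary_op_mat:
  assumes F: "unitary_op d F"
  shows "unitary_mat d (op_mat d F)"
proof -
  have "mat_adjoint (op_mat d F) * op_mat d F = 1\<^sub>m d"
  proof (rule eq_matI)
    fix i j assume "i < dim_row (1\<^sub>m d :: complex mat)" "j < dim_col (1\<^sub>m d :: complex mat)"
    then have ij: "i < d" "j < d" by auto
    then have "(mat_adjoint (op_mat d F) * op_mat d F) $$ (i, j) = ip d (F (delta i)) (F (delta j))"
      by (simp add: mat_adjoint_def op_mat_def scalar_prod_def ip_def atLeast0LessThan mat_of_rows_def)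
    also have "\<dots> = delta j i" using ij by (simp add: unitary_ip[OF F] ip_delta)
    finally show "(mat_adjoint (op_mat d F) * op_mat d F) $$ (i, j) = 1\<^sub>m d $$ (i, j)"
      using ij by (simp add: delta_def)
  qed (simp_all add: mat_adjoint_def op_mat_def)
  then show ?thesis by (simp add: unitary_mat_def op_mat_def)
qed

lemma query_perm_div2: "query_perm n x k div 2 = k div 2"
proof (cases "even k")
  case True then show ?thesis by (simp add: query_perm_def)
next
  case False
  then obtain j where "k = 2 * j + 1" by (rule oddE)
  then show ?thesis by (simp add: query_perm_def)
qed

lemma even_query_perm: "even (query_perm n x k) \<longleftrightarrow> (even k \<noteq> x ! ((k div 2) mod n))"
  by (simp add: query_perm_def)

text \<open>A number is determined by its half and its parity: the half never changes, and the
  parity is flipped twice or not at all.\<close>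

lemma query_perm_involution: "query_perm n x (query_perm n x k) = k"
proof -
  have "query_perm n x (query_perm n x k) div 2 = k div 2" by (simp add: query_perm_div2)
  moreover have "even (query_perm n x (query_perm n x k)) = even k"
    by (auto simp: even_query_perm query_perm_div2)
  ultimately show ?thesis using query_perm_div2 by presburger
qed

lemma query_perm_less: "k < 2 * d \<Longrightarrow> query_perm n x k < 2 * d"
  using div_less_iff_less_mult[of 2 k d] div_less_iff_less_mult[of 2 "query_perm n x k" d]
  by (simp add: query_perm_div2 mult.commute)
lemma query_mat_mult_vec:
  "query_mat n W x *\<^sub>v vec (query_dim n W) \<psi> = vec (query_dim n W) (\<lambda>k. \<psi> (query_perm n x k))"
    (is "?M *\<^sub>v vec ?D \<psi> = ?R")
proof (rule eq_vecI)
  fix r assume "r < dim_vec ?R"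
  then have r: "r < ?D" by simp
  then have pr: "query_perm n x r < ?D"
    using query_perm_less[of r "W * n"] by (simp add: query_dim_def ac_simps)
  have "(?M *\<^sub>v vec ?D \<psi>) $ r = (\<Sum>c<?D. if r = query_perm n x c then \<psi> c else 0)"
    using r by (simp add: query_mat_def scalar_prod_def atLeast0LessThan)
      (auto intro!: sum.cong)
  also have "\<dots> = (\<Sum>c<?D. if c = query_perm n x r then \<psi> c else 0)"
    by (intro sum.cong refl if_cong) (metis query_perm_involution)
  finally show "(?M *\<^sub>v vec ?D \<psi>) $ r = ?R $ r" using r pr by simp
qed (simp add: query_mat_def)

text \<open>On these states of the index register and answer qubit, a query acts as multiplication by \<open>phase x p\<close>.\<close>

definition kickback_state :: "nat option \<Rightarrow> nat \<Rightarrow> complex" where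
  "kickback_state p e = of_real (1 / sqrt 2) * (case p of
     None \<Rightarrow> if e div 2 = 0 then 1 else 0
   | Some i \<Rightarrow> if e div 2 = i then (if even e then 1 else - 1) else 0)"

text \<open>For \<open>Some i\<close> the two answer values carry opposite signs, so exchanging them
  produces the phase. For \<open>None\<close> they carry equal signs at index 0, and the compulsory
  query has no effect.\<close>

lemma kickback_query:
  assumes "0 < n" "e < 2 * n"
  shows "kickback_state p (query_perm n x e) = phase x p * kickback_state p e"
proof -
  have "e div 2 < n" using assms by linarith
  then show ?thesis
    by (cases p) (auto simp: kickback_state_def query_perm_div2 even_query_perm)
qed

lemma query_perm_shift:
  assumes "0 < n" "e < 2 * n"
  shows "query_perm n x (w * (2 * n) + e) = w * (2 * n) + query_perm n x e"
proof -
  have "(w * (2 * n) + e) div 2 = w * n + e div 2" by simp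
  moreover have "e div 2 < n" using assms by linarith
  ultimately show ?thesis using assms(2)
    by (auto simp: query_perm_def) (metis Nat.add_diff_assoc Suc_leI odd_pos One_nat_def)
qed

lemma nsq_kickback:
  assumes "0 < n" "set_option p \<subseteq> {..<n}"
  shows "nsq (2 * n) (kickback_state p) = 1"
proof -
  define j where "j = (case p of None \<Rightarrow> 0 | Some i \<Rightarrow> i)"
  have j: "j < n" using assms by (auto simp: j_def split: option.splits)
  have "nsq (2 * n) (kickback_state p) = (\<Sum>e<n * 2. if e div 2 = j then 1 / 2 else 0)"
    unfolding nsq_def mult.commute[of 2 n]
    by (intro sum.cong refl)
      (auto simp: kickback_state_def j_def norm_mult power_mult_distrib power_divide norm_divide split: option.splits)
  also have "\<dots> = (\<Sum>w<n. if w = j then 1 else 0)"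
  proof -
    have s2: "(\<Sum>e<2. f e) = f 0 + f 1" for f :: "nat \<Rightarrow> real" by (simp add: numeral_2_eq_2)
    show ?thesis unfolding sum_div_mod s2 by (intro sum.cong refl) simp
  qed
  finally show ?thesis using j by simp
qed

text \<open>The swap of the two states is one operator for both directions. An inadmissible
  \<open>p\<close> gets the identity, so that every \<open>R p\<close> is unitary.\<close>

lemma kickback_preparation_exists:
  assumes n: "0 < n"
  shows "\<exists>R. \<forall>p. unitary_op (2 * n) (R p) \<and> (set_option p \<subseteq> {..<n} \<longrightarrow>
     (\<forall>e<2 * n. R p (delta 0) e = kickback_state p e \<and> R p (kickback_state p) e = delta 0 e))"
proof (rule choice, rule allI)
  fix p
  show "\<exists>R. unitary_op (2 * n) R \<and> (set_option p \<subseteq> {..<n} \<longrightarrow>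
     (\<forall>e<2 * n. R (delta 0) e = kickback_state p e \<and> R (kickback_state p) e = delta 0 e))"
  proof (cases "set_option p \<subseteq> {..<n}")
    case True
    have 1: "ip (2 * n) (delta 0) (delta 0) = ip (2 * n) (kickback_state p) (kickback_state p)"
      using n by (simp add: ip_self nsq_kickback[OF n True] nsq_delta)
    have "ip (2 * n) (delta 0) (kickback_state p) = kickback_state p 0" using n by (simp add: ip_delta)
    moreover from this have "ip (2 * n) (kickback_state p) (delta 0) = cnj (kickback_state p 0)"
      using cnj_ip[of "2 * n" "delta 0" "kickback_state p"] by simp
    ultimately have 2: "ip (2 * n) (delta 0) (kickback_state p) = ip (2 * n) (kickback_state p) (delta 0)"
      by (simp add: kickback_state_def split: option.splits)
    show ?thesis by (rule swap_exists[OF 1 2]) blast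
  next
    case False
    then show ?thesis by (intro exI[of _ "\<lambda>\<psi>. \<psi>"]) (simp add: unitary_id)
  qed
qed

lemma sum_less_filter:
  fixes f :: "nat \<Rightarrow> real"
  shows "(\<Sum>k | k < d \<and> Q k. f k) = (\<Sum>k<d. if Q k then f k else 0)"
  using sum.inter_filter[of "{..<d}" f Q] by simp

theorem implementable_query_algorithm:
  assumes n: "0 < n" and p: "implementable n T p"
  shows "\<exists>A. query_algorithm_on n A \<and> queries A = T \<and>
    (\<forall>x v. length x = n \<longrightarrow> output_prob n A x v = p x v)"
proof -
  obtain W \<Psi> out where out: "outputs n W T \<Psi> out p" using p unfolding implementable_def by blast
  note W = outputsD(1,2)[OF out] and pe = outputsD(3)[OF out]
  obtain F q where Fq: "prepares n W T F q \<Psi>" using W(2) by (auto simp: reach_def)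
  note v = preparesD(1)[OF Fq] and \<Psi> = preparesD(2)[OF Fq]
  have U: "unitary_op W (F t)" for t using v by (simp add: valid_gates_def)
  have q: "set_option (q t w) \<subseteq> {..<n}" for t w using v by (simp add: valid_gates_def)
  obtain R where R: "\<forall>p. unitary_op (2 * n) (R p) \<and> (set_option p \<subseteq> {..<n} \<longrightarrow>
     (\<forall>e<2 * n. R p (delta 0) e = kickback_state p e \<and> R p (kickback_state p) e = delta 0 e))"
    using kickback_preparation_exists[OF n] by blast
  define N where "N = 2 * n"
  have N: "0 < N" using n by (simp add: N_def)
  define D where "D = W * N"
  have D: "query_dim n W = D" by (simp add: query_dim_def D_def N_def)
  define P where "P = (\<lambda>t. ctl_op N (\<lambda>w. R (q t w)))"
  have UR: "unitary_op N (R p)" for p using R by (simp add: N_def)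
  have UP: "unitary_op D (P t)" for t
    unfolding D_def P_def by (rule unitary_ctl) (rule UR)
  define G where "G = (\<lambda>t. case t of 0 \<Rightarrow> (\<lambda>\<psi>. P 0 (lift_op N (F 0) \<psi>))
    | Suc t' \<Rightarrow> (\<lambda>\<psi>. P (Suc t') (lift_op N (F (Suc t')) (P t' \<psi>))))"
  have UL: "unitary_op D (lift_op N (F t))" for t unfolding D_def by (rule unitary_lift) (rule U)
  have UG: "unitary_op D (G t)" for t
    by (cases t) (simp_all add: G_def unitary_comp[OF UP UL] unitary_comp[OF UP unitary_comp[OF UL UP]])
  define A where "A = \<lparr>queries = T, workspace = W, gate = (\<lambda>t. op_mat D (G t)), readout = (\<lambda>k. out (k div N))\<rparr>"
  have on: "query_algorithm_on n A"
    using W(1) UG by (simp add: query_algorithm_on_def A_def D unitary_op_mat)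
  have prep: "P t (\<lambda>k. \<psi> (k div N) * delta 0 (k mod N)) = (\<lambda>k. \<psi> (k div N) * kickback_state (q t (k div N)) (k mod N))"
    for t \<psi> unfolding P_def
    by (rule ctl_op_prod[where \<phi> = "\<lambda>_. delta 0" and \<chi> = "\<lambda>w. kickback_state (q t w)", OF UR _ N])
      (use R q in \<open>simp add: N_def\<close>)
  have unprep: "P t (\<lambda>k. \<psi> (k div N) * kickback_state (q t (k div N)) (k mod N)) = (\<lambda>k. \<psi> (k div N) * delta 0 (k mod N))"
    for t \<psi> unfolding P_def
    by (rule ctl_op_prod[where \<chi> = "\<lambda>_. delta 0" and \<phi> = "\<lambda>w. kickback_state (q t w)", OF UR _ N])
      (use R q in \<open>simp add: N_def\<close>)
  note lift = lift_op_prod[OF unitary_linear[OF U] N]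
  have step: "G (Suc t) (\<lambda>k. \<psi> (k div N) * kickback_state (q t (k div N)) (k mod N)) =
      (\<lambda>k. F (Suc t) \<psi> (k div N) * kickback_state (q (Suc t) (k div N)) (k mod N))" for t \<psi>
    by (simp add: G_def unprep lift prep)
  have delta: "delta 0 = (\<lambda>k. delta 0 (k div N) * delta 0 (k mod N))" by (rule ext) (rule delta_div_mod)
  have state: "query_state n A x t =
      vec D (\<lambda>k. phase_state F q x t (k div N) * kickback_state (q t (k div N)) (k mod N))" for x t
  proof (induction t)
    case 0
    have "unit_vec D 0 = vec D (delta 0)" by (rule eq_vecI) (auto simp: delta_def unit_vec_def)
    then have "query_state n A x 0 = vec D (G 0 (delta 0))"
      by (simp add: A_def D op_mat_mult_vec[OF UG])
    also have "G 0 (delta 0) = P 0 (lift_op N (F 0) (\<lambda>k. delta 0 (k div N) * delta 0 (k mod N)))"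
      by (subst delta) (simp add: G_def)
    finally show ?case by (simp add: lift prep)
  next
    case (Suc t)
    let ?\<psi> = "\<lambda>w. phase x (q t w) * phase_state F q x t w"
    have perm: "query_perm n x k div N = k div N" "kickback_state (q t (k div N)) (query_perm n x k mod N) =
        phase x (q t (k div N)) * kickback_state (q t (k div N)) (k mod N)" for k
    proof -
      have e: "k mod N < 2 * n" using N by (simp add: N_def)
      have pe: "query_perm n x (k mod N) < N" using query_perm_less[OF e] by (simp add: N_def)
      have "query_perm n x k = k div N * N + query_perm n x (k mod N)"
        using query_perm_shift[OF n e, of x "k div N"] unfolding N_def by (simp only: div_mult_mod_eq)
      then show "query_perm n x k div N = k div N" "kickback_state (q t (k div N)) (query_perm n x k mod N) =
        phase x (q t (k div N)) * kickback_state (q t (k div N)) (k mod N)"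
        using pe kickback_query[OF n e] by simp_all
    qed
    have "query_mat n W x *\<^sub>v query_state n A x t =
        vec D (\<lambda>k. ?\<psi> (k div N) * kickback_state (q t (k div N)) (k mod N))"
      unfolding Suc D[symmetric] query_mat_mult_vec perm by (simp add: ac_simps)
    then have "query_state n A x (Suc t) =
        vec D (G (Suc t) (\<lambda>k. ?\<psi> (k div N) * kickback_state (q t (k div N)) (k mod N)))"
      by (simp add: A_def op_mat_mult_vec[OF UG])
    then show ?case using step[of t ?\<psi>] by simp
  qed
  have A: "queries A = T" "workspace A = W" "readout A = (\<lambda>k. out (k div N))"
    by (simp_all add: A_def)
  have "output_prob n A x v = p x v" if x: "length x = n" for x v
  proof -
    let ?s = "phase_state F q x T"
    have "output_prob n A x v = (\<Sum>k | k < D \<and> out (k div N) = v. (cmod (query_state n A x T $ k))\<^sup>2)"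
      by (simp add: output_prob_def A D)
    also have "\<dots> = (\<Sum>k<D. if out (k div N) = v
        then (cmod (?s (k div N) * kickback_state (q T (k div N)) (k mod N)))\<^sup>2 else 0)"
      unfolding sum_less_filter by (intro sum.cong refl) (simp add: state)
    also have "\<dots> = (\<Sum>w<W. \<Sum>e<N. (if out w = v then (cmod (?s w))\<^sup>2 else 0) * (cmod (kickback_state (q T w) e))\<^sup>2)"
      unfolding D_def sum_div_mod by (intro sum.cong refl) (simp add: norm_mult power_mult_distrib)
    also have "\<dots> = (\<Sum>w<W. (if out w = v then (cmod (?s w))\<^sup>2 else 0) * nsq N (kickback_state (q T w)))"
      by (simp add: nsq_def sum_distrib_left)
    also have "\<dots> = (\<Sum>w<W. if out w = v then (cmod (?s w))\<^sup>2 else 0)"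
      using nsq_kickback[OF n q] by (simp add: N_def)
    also have "\<dots> = p x v"
      unfolding pe[OF x] sum_less_filter by (intro sum.cong refl) (simp add: \<Psi>[OF x])
    finally show ?thesis .
  qed
  with on A(1) show ?thesis by (intro exI[of _ A]) simp
qed

section \<open>The zero-error algorithm\<close>

lemma reflection_about_vector:
  assumes v: "nsq d v = 1"
  shows "unitary_op d (\<lambda>\<psi> s. 2 * ip d v \<psi> * v s - \<psi> s)"
proof -
  have vv: "ip d v v = 1" using v by (simp add: ip_self)
  let ?R = "\<lambda>\<psi> s. 2 * ip d v \<psi> * v s - \<psi> s"
  have "linear_op ?R"
    unfolding linear_op_def ip_simps by (auto simp: algebra_simps)
  moreover have "ip d (?R \<psi>) (?R \<phi>) = ip d \<psi> \<phi>" for \<psi> \<phi>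
    unfolding ip_simps vv using cnj_ip[of d v \<psi>] by (simp add: algebra_simps)
  ultimately show ?thesis by (simp add: unitary_op_def)
qed

text \<open>Amplitudes after \<open>t\<close> Grover iterations with \<open>w\<close> marked positions: the first component is
  that of a marked position, the second one the factor of the unmarked part of the start vector.\<close>

primrec grover_coeffs :: "real \<Rightarrow> nat \<Rightarrow> nat \<Rightarrow> real \<times> real" where
  "grover_coeffs a w 0 = (a, 1)"
| "grover_coeffs a w (Suc t) =
    (let (\<alpha>, \<beta>) = grover_coeffs a w t; c = \<beta> * (1 - w * a\<^sup>2) - \<alpha> * a * w
     in (\<alpha> + 2 * c * a, 2 * c - \<beta>))"

definition marked :: "nat \<Rightarrow> (nat \<Rightarrow> nat) \<Rightarrow> bool list \<Rightarrow> nat set" where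
  "marked m pos x = {j. j < m \<and> x ! pos j}"

text \<open>The extra label \<open>m\<close> carries no query; it lowers the initial amplitude on the positions, so
  that the Grover angle can be tuned.\<close>

definition grover_start :: "nat \<Rightarrow> real \<Rightarrow> nat \<Rightarrow> real" where
  "grover_start m a s = (if s < m then a else sqrt (1 - m * a\<^sup>2))"

definition grover_state :: "nat \<Rightarrow> (nat \<Rightarrow> nat) \<Rightarrow> real \<Rightarrow> nat \<Rightarrow> bool list \<Rightarrow> nat \<Rightarrow> real" where
  "grover_state m pos a t x s =
     (let (\<alpha>, \<beta>) = grover_coeffs a (card (marked m pos x)) t
      in if s \<in> marked m pos x then \<alpha> else \<beta> * grover_start m a s)"

lemma sum_marked:
  fixes u v :: real
  shows "(\<Sum>s<m. if s \<in> marked m pos x then u else v) =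
    card (marked m pos x) * u + (real m - card (marked m pos x)) * v"
proof -
  have sub: "marked m pos x \<subseteq> {..<m}" by (auto simp: marked_def)
  have "(\<Sum>s<m. if s \<in> marked m pos x then u else v) = (\<Sum>s<m. v + (if s \<in> marked m pos x then u - v else 0))"
    by (intro sum.cong) auto
  also have "\<dots> = m * v + (\<Sum>s\<in>marked m pos x. u - v)"
  proof -
    have "(\<Sum>s<m. if s \<in> marked m pos x then u - v else 0) = (\<Sum>s\<in>marked m pos x. u - v)"
      by (rule sum.mono_neutral_cong_right) (use sub in auto)
    then show ?thesis by (simp add: sum.distrib)
  qed
  finally show ?thesis by (simp add: algebra_simps)
qed

lemma grover_start_norm:
  fixes a :: real
  assumes "m * a\<^sup>2 \<le> 1"
  shows "nsq (Suc m) (\<lambda>s. of_real (grover_start m a s)) = 1"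
  using assms by (simp add: nsq_def grover_start_def)

text \<open>An iteration is a sign query followed by the reflection about the start vector. The
  local value \<open>c\<close> in \<open>grover_coeffs\<close> is the inner product of the start
  vector with the state after the query.\<close>

lemma grover_reach:
  fixes a :: real
  assumes a: "m * a\<^sup>2 \<le> 1" and pos: "\<And>j. j < m \<Longrightarrow> pos j < n"
  shows "reach n (Suc m) t (\<lambda>x s. of_real (grover_state m pos a t x s))"
proof (induction t)
  case 0
  let ?v = "\<lambda>s. complex_of_real (grover_start m a s)"
  have 1: "ip (Suc m) (delta 0) (delta 0) = ip (Suc m) ?v ?v"
    by (simp add: ip_self grover_start_norm[OF a] nsq_delta)
  have "ip (Suc m) (delta 0) ?v = ?v 0" by (simp add: ip_delta)
  then have 2: "ip (Suc m) (delta 0) ?v = ip (Suc m) ?v (delta 0)"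
    using cnj_ip[of "Suc m" "delta 0" ?v] by simp
  obtain R where R: "unitary_op (Suc m) R" "\<And>s. s < Suc m \<Longrightarrow> R (delta 0) s = ?v s"
    by (rule swap_exists[OF 1 2]) blast
  show ?case
    by (rule reach_cong[OF reach_gate[OF reach_delta R(1)]])
      (simp add: R(2) grover_state_def grover_start_def marked_def)
next
  case (Suc t)
  let ?v = "\<lambda>s. complex_of_real (grover_start m a s)"
  let ?q = "\<lambda>s. if s < m then Some (pos s) else None"
  let ?R = "\<lambda>\<psi> s. 2 * ip (Suc m) ?v \<psi> * ?v s - \<psi> s"
  let ?\<psi> = "\<lambda>x s. phase x (?q s) * of_real (grover_state m pos a t x s)"
  have "reach n (Suc m) (Suc t) ?\<psi>"
    by (rule reach_query[OF Suc]) (use pos in auto)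
  then have R: "reach n (Suc m) (Suc t) (\<lambda>x. ?R (?\<psi> x))"
    by (rule reach_gate) (rule reflection_about_vector[OF grover_start_norm[OF a]])
  show ?case
  proof (rule reach_cong[OF R])
    fix x :: "bool list" and s
    assume s: "s < Suc m"
    obtain \<alpha> \<beta> where c: "grover_coeffs a (card (marked m pos x)) t = (\<alpha>, \<beta>)" by (cases "grover_coeffs a (card (marked m pos x)) t")
    let ?w = "card (marked m pos x)"
    have \<psi>: "?\<psi> x s = of_real (if s \<in> marked m pos x then - \<alpha> else \<beta> * grover_start m a s)" for s
    proof -
      have "phase x (?q s) = (if s \<in> marked m pos x then - 1 else 1)" by (simp add: marked_def)
      then show ?thesis by (simp add: grover_state_def c)
    qed
    have b: "(sqrt (1 - m * a\<^sup>2)) * (sqrt (1 - m * a\<^sup>2)) = 1 - m * a\<^sup>2" using a by simp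
    have "ip (Suc m) ?v (?\<psi> x) = of_real (\<Sum>s<Suc m. grover_start m a s *
        (if s \<in> marked m pos x then - \<alpha> else \<beta> * grover_start m a s))"
      unfolding ip_def \<psi> by simp
    also have "(\<Sum>s<Suc m. grover_start m a s * (if s \<in> marked m pos x then - \<alpha> else \<beta> * grover_start m a s))
      = (\<Sum>s<m. if s \<in> marked m pos x then - a * \<alpha> else \<beta> * a\<^sup>2) + \<beta> * (1 - m * a\<^sup>2)"
    proof -
      have "(\<Sum>s<m. grover_start m a s * (if s \<in> marked m pos x then - \<alpha> else \<beta> * grover_start m a s))
        = (\<Sum>s<m. if s \<in> marked m pos x then - a * \<alpha> else \<beta> * a\<^sup>2)"
        by (intro sum.cong refl) (simp add: grover_start_def power2_eq_square)
      moreover have "m \<notin> marked m pos x" by (simp add: marked_def)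
      ultimately show ?thesis using b by (simp add: grover_start_def mult.left_commute)
    qed
    \<comment> \<open>The unmarked mass is \<open>(m - w) * a^2\<close> on positions and
      \<open>1 - m * a^2\<close> on the extra label, so \<open>m\<close> cancels.\<close>
    also have "\<dots> = \<beta> * (1 - ?w * a\<^sup>2) - \<alpha> * a * ?w"
      unfolding sum_marked by (simp add: algebra_simps)
    finally have ip: "ip (Suc m) ?v (?\<psi> x) = of_real (\<beta> * (1 - ?w * a\<^sup>2) - \<alpha> * a * ?w)" .
    have st: "grover_start m a s = a" if "s \<in> marked m pos x"
      using that by (simp add: marked_def grover_start_def)
    show "of_real (grover_state m pos a (Suc t) x s) = ?R (?\<psi> x) s"
      unfolding ip unfolding \<psi> by (simp add: grover_state_def c Let_def st algebra_simps)
  qed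
qed

text \<open>Each iteration rotates by \<open>2 * \<theta>\<close> in the plane of the marked
  position and the rest of the start vector. That rest has norm \<open>cos \<theta>\<close>, whence
  the division.\<close>

lemma grover_coeffs_single:
  assumes "cos \<theta> \<noteq> 0"
  shows "grover_coeffs (sin \<theta>) 1 t = (sin (real (2 * t + 1) * \<theta>), cos (real (2 * t + 1) * \<theta>) / cos \<theta>)"
proof (induction t)
  case 0
  then show ?case using assms by simp
next
  case (Suc t)
  define \<phi> where "\<phi> = real (2 * t + 1) * \<theta>"
  have \<phi>: "real (2 * Suc t + 1) * \<theta> = \<phi> + 2 * \<theta>" by (simp add: \<phi>_def algebra_simps)
  have sq: "1 - (sin \<theta>)\<^sup>2 = cos \<theta> * cos \<theta>" using sin_cos_squared_add[of \<theta>] by (simp add: power2_eq_square)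
  have c: "cos \<phi> / cos \<theta> * (1 - real 1 * (sin \<theta>)\<^sup>2) - sin \<phi> * sin \<theta> * real 1 = cos (\<phi> + \<theta>)"
    using assms by (simp add: sq cos_add)
  have arg: "\<phi> + \<theta> + \<theta> = \<phi> + 2 * \<theta>" "\<phi> + \<theta> - \<theta> = \<phi>" by simp_all
  have 1: "sin \<phi> + 2 * cos (\<phi> + \<theta>) * sin \<theta> = sin (\<phi> + 2 * \<theta>)"
    using sin_add[of "\<phi> + \<theta>" \<theta>] sin_diff[of "\<phi> + \<theta>" \<theta>] unfolding arg by simp
  have "cos (\<phi> + 2 * \<theta>) + cos \<phi> = 2 * cos (\<phi> + \<theta>) * cos \<theta>"
    using cos_add[of "\<phi> + \<theta>" \<theta>] cos_diff[of "\<phi> + \<theta>" \<theta>] unfolding arg by simp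
  then have 2: "2 * cos (\<phi> + \<theta>) - cos \<phi> / cos \<theta> = cos (\<phi> + 2 * \<theta>) / cos \<theta>"
    using assms by (simp add: field_simps)
  show ?case unfolding grover_coeffs.simps Suc Let_def prod.case \<phi>_def[symmetric] c 1 2 \<phi> ..
qed

text \<open>For weight other than 1, every position has a rival that is at least as likely: another
  marked position, or, for an unmarked one, the extra label \<open>m\<close>. Two probabilities sum
  to at most 1, hence the bound 1/2, whatever rotation took place.\<close>

lemma grover_exists:
  assumes m: "0 < m" and pos: "\<And>j. j < m \<Longrightarrow> pos j < n"
  defines "k \<equiv> 2 * nat \<lceil>sqrt m\<rceil>"
  shows "\<exists>p. implementable n k p \<and> (\<forall>x. length x = n \<longrightarrow>
     (\<forall>j>m. p x j = 0) \<and>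
     (card (marked m pos x) = 1 \<longrightarrow> (\<forall>j\<in>marked m pos x. p x j = 1)) \<and>
     (card (marked m pos x) \<noteq> 1 \<longrightarrow> (\<forall>j<m. p x j \<le> 1 / 2)))"
proof -
  \<comment> \<open>Chosen so that \<open>k\<close> iterations turn a single marked position to the
    angle \<open>pi / 2\<close> exactly.\<close>
  define \<theta> where "\<theta> = pi / (2 * real (2 * k + 1))"
  define a where "a = sin \<theta>"
  have k: "k \<ge> 2 * sqrt m"
    unfolding k_def using of_nat_ceiling[of "sqrt m"] by simp
  have \<theta>0: "0 < \<theta>" by (simp add: \<theta>_def)
  have \<theta>1: "\<theta> \<le> pi / 6"
  proof -
    have "1 \<le> sqrt m" using m by simp
    then have "k \<ge> 1" using k by linarith
    then show ?thesis unfolding \<theta>_def by (intro divide_left_mono) auto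
  qed
  have cos: "cos \<theta> \<noteq> 0"
    using cos_gt_zero[of \<theta>] \<theta>0 \<theta>1 pi_gt_zero by (simp add: less_imp_neq[symmetric])
  \<comment> \<open>This leaves the extra label an initial amplitude of at least \<open>a\<close>,
    which makes it the rival of the unmarked positions.\<close>
  have a2: "m * a\<^sup>2 \<le> 1 / 2"
  proof -
    have s: "0 < sqrt m" using m by simp
    have "a \<le> \<theta>" "0 \<le> a" unfolding a_def using \<theta>0 \<theta>1 pi_gt_zero by (auto intro!: sin_x_le_x sin_ge_zero)
    moreover have "\<theta> \<le> pi / (8 * sqrt m)"
      unfolding \<theta>_def using k s pi_gt_zero by (intro divide_left_mono) auto
    moreover have "pi / (8 * sqrt m) \<le> 1 / (2 * sqrt m)"
      using pi_less_4 s by (simp add: field_simps)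
    ultimately have "a \<le> 1 / (2 * sqrt m)" by linarith
    then have "a\<^sup>2 \<le> (1 / (2 * sqrt m))\<^sup>2" using \<open>0 \<le> a\<close> by (rule power_mono)
    also have "\<dots> = 1 / (4 * m)" by (simp add: power_divide power_mult_distrib)
    finally show ?thesis using m by (simp add: field_simps)
  qed
  define p where "p = (\<lambda>x j. if j \<le> m then (grover_state m pos a k x j)\<^sup>2 else 0)"
  have reach: "reach n (Suc m) k (\<lambda>x s. of_real (grover_state m pos a k x s))"
    by (rule grover_reach) (use a2 pos in auto)
  have impl: "implementable n k p"
  proof (rule implementableI[OF _ reach])
    fix x :: "bool list" and v
    have "{s. s < Suc m \<and> s = v} = (if v \<le> m then {v} else {})" by auto
    then show "p x v = (\<Sum>s | s < Suc m \<and> s = v. (cmod (of_real (grover_state m pos a k x s)))\<^sup>2)"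
      by (simp add: p_def)
  qed simp
  have two: "p x i + p x j \<le> 1" if "length x = n" "i \<noteq> j" "i \<le> m" "j \<le> m" for x i j
  proof -
    have "(\<Sum>k\<le>m. p x k) = 1"
      by (rule implementable_total[OF impl that(1)]) (auto simp: p_def)
    moreover have "(\<Sum>k\<in>{i, j}. p x k) \<le> (\<Sum>k\<le>m. p x k)"
      by (rule sum_mono2) (use that in \<open>auto simp: p_def\<close>)
    ultimately show ?thesis using that(2) by simp
  qed
  have "p x j = 1" if "card (marked m pos x) = 1" "j \<in> marked m pos x" for x j
  proof -
    have half_pi: "c * (pi / (2 * c)) = pi / 2" if "c \<noteq> 0" for c :: real using that by simp
    have angle: "real (2 * k + 1) * \<theta> = pi / 2" unfolding \<theta>_def by (rule half_pi) simp
    have "grover_coeffs a 1 k = (1, 0)" unfolding a_def grover_coeffs_single[OF cos] angle by simp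
    moreover have "j \<le> m" using that(2) by (simp add: marked_def)
    ultimately show ?thesis by (simp add: p_def grover_state_def that)
  qed
  moreover have "p x j \<le> 1 / 2" if x: "length x = n" and w: "card (marked m pos x) \<noteq> 1" and j: "j < m" for x j
  proof (cases "j \<in> marked m pos x")
    case True
    have "\<exists>i\<in>marked m pos x. i \<noteq> j"
    proof (rule ccontr)
      assume "\<not> ?thesis"
      then have "marked m pos x = {j}" using True by blast
      then show False using w by simp
    qed
    then obtain i where i: "i \<in> marked m pos x" "i \<noteq> j" by blast
    then have "i < m" by (simp add: marked_def)
    moreover have "p x i = p x j" using i True j \<open>i < m\<close> by (simp add: p_def grover_state_def)
    ultimately show ?thesis using two[OF x i(2)] j by simp
  next
    case False
    obtain \<alpha> \<beta> where c: "grover_coeffs a (card (marked m pos x)) k = (\<alpha>, \<beta>)"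
      by (cases "grover_coeffs a (card (marked m pos x)) k")
    have "1 * a\<^sup>2 \<le> m * a\<^sup>2" using m by (intro mult_right_mono) auto
    then have "a\<^sup>2 \<le> 1 - m * a\<^sup>2" using a2 by linarith
    then have "\<beta>\<^sup>2 * a\<^sup>2 \<le> \<beta>\<^sup>2 * (1 - m * a\<^sup>2)" by (rule mult_left_mono) simp
    moreover have "m \<notin> marked m pos x" by (simp add: marked_def)
    ultimately have "p x j \<le> p x m"
      using False j a2 by (simp add: p_def grover_state_def c grover_start_def power_mult_distrib)
    then show ?thesis using two[OF x, of j m] j by simp
  qed
  ultimately show ?thesis using impl by (intro exI[of _ p]) (auto simp: p_def)
qed

text \<open>The probability that two independent runs agree on a position is the sum of the
  \<open>p_i^2\<close>, at most the largest \<open>p_i\<close>, hence at most 1/2 unless the weight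
  is 1. Outcome \<open>True\<close> means certified.\<close>

lemma not_single_test_exists:
  assumes m: "0 < m" and pos: "\<And>j. j < m \<Longrightarrow> pos j < n"
  shows "\<exists>r. implementable n (4 * nat \<lceil>sqrt m\<rceil>) r \<and> (\<forall>x. length x = n \<longrightarrow>
     (card (marked m pos x) = 1 \<longrightarrow> r x True = 0) \<and> (card (marked m pos x) \<noteq> 1 \<longrightarrow> r x True \<ge> 1 / 2))"
proof -
  define k where "k = 2 * nat \<lceil>sqrt m\<rceil>"
  obtain p where impl: "implementable n k p"
    and zero: "\<And>x j. length x = n \<Longrightarrow> m < j \<Longrightarrow> p x j = 0"
    and one: "\<And>x j. length x = n \<Longrightarrow> card (marked m pos x) = 1 \<Longrightarrow> j \<in> marked m pos x \<Longrightarrow> p x j = 1"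
    and half: "\<And>x j. length x = n \<Longrightarrow> card (marked m pos x) \<noteq> 1 \<Longrightarrow> j < m \<Longrightarrow> p x j \<le> 1 / 2"
    using grover_exists[OF m, of pos n] pos unfolding k_def by blast
  \<comment> \<open>Agreement on the extra label \<open>m\<close> counts as certified: its
    probability is not bounded by 1/2, and weight 1 never produces it.\<close>
  define e :: "nat \<Rightarrow> nat \<Rightarrow> bool \<Rightarrow> real" where "e = (\<lambda>i j v. if v = (\<not> (i = j \<and> i < m)) then 1 else 0)"
  define s where "s = (\<lambda>i x v. \<Sum>j\<le>m. p x j * e i j v)"
  define r where "r = (\<lambda>x v. \<Sum>i\<le>m. p x i * s i x v)"
  have "implementable n 0 (\<lambda>x. e i j)" for i j
    unfolding e_def by (rule implementable_return)
  then have "implementable n (k + 0) (s i)" for i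
    unfolding s_def using impl zero by (intro implementable_bind[of n k p 0 "\<lambda>j x. e i j"]) auto
  then have "implementable n (k + k) r"
    unfolding r_def using impl zero by (intro implementable_bind[of n k p k s]) auto
  then have r: "implementable n (4 * nat \<lceil>sqrt m\<rceil>) r" by (simp add: k_def)
  have p0: "p x j \<ge> 0" if "length x = n" for x j by (rule implementable_nonneg[OF impl that])
  have p1: "(\<Sum>i\<le>m. p x i) = 1" if "length x = n" for x
    by (rule implementable_total[OF impl that]) (use zero that in auto)
  have r1: "r x True = 1 - r x False" if "length x = n" for x
    using implementable_total[OF r that, of UNIV] by (simp add: UNIV_bool)
  have sF: "s i x False = (if i < m then p x i else 0)" if "i \<le> m" for i x
  proof -
    have "s i x False = (\<Sum>j\<le>m. if j = i then (if i < m then p x i else 0) else 0)"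
      unfolding s_def e_def by (intro sum.cong) auto
    then show ?thesis using that by simp
  qed
  have "r x True = 0" if x: "length x = n" and w: "card (marked m pos x) = 1" for x
  proof -
    obtain j where j: "j \<in> marked m pos x" using w by fastforce
    then have "j < m" by (simp add: marked_def)
    have "p x j * s j x False \<le> r x False"
      unfolding r_def by (rule member_le_sum) (use \<open>j < m\<close> p0[OF x] sF in auto)
    then have "r x False \<ge> 1" using one[OF x w j] sF[of j] \<open>j < m\<close> by simp
    then show ?thesis using r1[OF x] implementable_nonneg[OF r x, of True] by simp
  qed
  moreover have "r x True \<ge> 1 / 2" if x: "length x = n" and w: "card (marked m pos x) \<noteq> 1" for x
  proof -
    have "r x False \<le> (\<Sum>i\<le>m. p x i * (1 / 2))"
      unfolding r_def by (intro sum_mono mult_left_mono) (use half[OF x w] p0[OF x] sF in auto)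
    also have "\<dots> = 1 / 2" unfolding sum_distrib_right[symmetric] p1[OF x] by simp
    finally show ?thesis using r1[OF x] by simp
  qed
  ultimately show ?thesis using r by (intro exI[of _ r]) simp
qed

section \<open>Search through the blocks\<close>

lemma Exact_one_block:
  "Exact_one (block m x i) \<longleftrightarrow> card (marked m (\<lambda>j. i * m + j) x) = 1"
proof -
  have "{j. j < length (block m x i) \<and> block m x i ! j} = marked m (\<lambda>j. i * m + j) x"
    by (auto simp: block_def marked_def)
  then show ?thesis by (simp add: Exact_one_def hamming_weight_def)
qed

lemma f_and_not_exact_iff: "f_and_not_exact m x \<longleftrightarrow> (\<forall>i<m. \<not> Exact_one (block m x i))"
  by (auto simp: f_and_not_exact_def block_compose_def AND_fn_def)

lemma block_index_less: "i < m \<Longrightarrow> j < m \<Longrightarrow> i * m + j < m\<^sup>2" for i j m :: nat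
proof -
  assume "i < m" "j < m"
  then have "i * m + j < Suc i * m" by simp
  also have "\<dots> \<le> m * m" using \<open>i < m\<close> by (intro mult_right_mono) auto
  finally show ?thesis by (simp add: power2_eq_square)
qed

text \<open>After \<open>N\<close> tests that start from block \<open>i\<close> and pass to the next block whenever the current one
  is certified, the current block is read completely.\<close>

lemma zero_error_search:
  fixes N i :: nat
  assumes m: "0 < m" and "i \<le> m"
  shows "\<exists>p. implementable (m\<^sup>2) (N * (4 * nat \<lceil>sqrt m\<rceil>) + m) p \<and>
    (\<forall>x. length x = m\<^sup>2 \<longrightarrow> (\<forall>i'<i. \<not> Exact_one (block m x i')) \<longrightarrow>
       p x (Some (\<not> f_and_not_exact m x)) = 0 \<and>
       p x None \<le> (if i = m \<or> Exact_one (block m x i) then 0 else (2 / 3) ^ N * 3 ^ (m - i)))"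
  using assms(2)
proof (induction N arbitrary: i)
  case 0
  show ?case
  proof (cases "i = m")
    case True
    then show ?thesis
      by (intro exI[of _ "\<lambda>x v. if v = Some True then 1 else 0"])
        (auto simp: f_and_not_exact_iff intro: implementable_return)
  next
    case False
    \<comment> \<open>One bad block refutes the conjunction; a good block says nothing about the
      later ones.\<close>
    let ?g = "\<lambda>bs. if Exact_one bs then Some False else None"
    have js: "set (map (\<lambda>j. i * m + j) [0..<m]) \<subseteq> {..<m\<^sup>2}"
    proof
      fix y assume "y \<in> set (map (\<lambda>j. i * m + j) [0..<m])"
      then obtain j where "j \<in> set [0..<m]" "y = i * m + j" unfolding set_map by blast
      then show "y \<in> {..<m\<^sup>2}" using block_index_less[of i m j] 0 False by simp
    qed
    have "implementable (m\<^sup>2) m (\<lambda>x v. if v = ?g (block m x i) then 1 else 0)"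
      using implementable_read[OF js, of ?g] by (simp add: block_def comp_def)
    moreover have "f_and_not_exact m x = False" if "Exact_one (block m x i)" for x
      using that le_neq_implies_less[OF 0 False] by (auto simp: f_and_not_exact_iff)
    ultimately show ?thesis using False
      by (intro exI[of _ "\<lambda>x v. if v = ?g (block m x i) then 1 else 0"]) auto
  qed
next
  case (Suc N)
  let ?\<tau> = "4 * nat \<lceil>sqrt m\<rceil>"
  show ?case
  proof (cases "i = m")
    case True
    then show ?thesis
      by (intro exI[of _ "\<lambda>x v. if v = Some True then 1 else 0"])
        (auto simp: f_and_not_exact_iff intro: implementable_return)
  next
    case False
    then have i: "i < m" using Suc.prems by simp
    obtain r where r: "implementable (m\<^sup>2) ?\<tau> r"
      and rE: "\<And>x. length x = m\<^sup>2 \<Longrightarrow> Exact_one (block m x i) \<Longrightarrow> r x True = 0"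
      and rN: "\<And>x. length x = m\<^sup>2 \<Longrightarrow> \<not> Exact_one (block m x i) \<Longrightarrow> r x True \<ge> 1 / 2"
      using not_single_test_exists[OF m, of "\<lambda>j. i * m + j" "m\<^sup>2"] block_index_less[OF i]
      unfolding Exact_one_block by blast
    obtain p0 where p0: "implementable (m\<^sup>2) (N * ?\<tau> + m) p0"
      and p0x: "\<And>x. length x = m\<^sup>2 \<Longrightarrow> (\<forall>i'<i. \<not> Exact_one (block m x i')) \<Longrightarrow>
       p0 x (Some (\<not> f_and_not_exact m x)) = 0 \<and>
       p0 x None \<le> (if i = m \<or> Exact_one (block m x i) then 0 else (2 / 3) ^ N * 3 ^ (m - i))"
      using Suc.IH[OF Suc.prems] by blast
    obtain p1 where p1: "implementable (m\<^sup>2) (N * ?\<tau> + m) p1"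
      and p1x: "\<And>x. length x = m\<^sup>2 \<Longrightarrow> (\<forall>i'<Suc i. \<not> Exact_one (block m x i')) \<Longrightarrow>
       p1 x (Some (\<not> f_and_not_exact m x)) = 0 \<and>
       p1 x None \<le> (if Suc i = m \<or> Exact_one (block m x (Suc i)) then 0 else (2 / 3) ^ N * 3 ^ (m - Suc i))"
      using Suc.IH[of "Suc i"] i by (meson Suc_leI)
    define p where "p = (\<lambda>x v. r x True * p1 x v + r x False * p0 x v)"
    have "implementable (m\<^sup>2) (?\<tau> + (N * ?\<tau> + m)) (\<lambda>x v. \<Sum>b\<in>UNIV. r x b * (if b then p1 else p0) x v)"
      by (rule implementable_bind[OF r]) (use p0 p1 in auto)
    then have impl: "implementable (m\<^sup>2) (Suc N * ?\<tau> + m) p"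
      by (simp add: UNIV_bool p_def algebra_simps)
    moreover have "p x (Some (\<not> f_and_not_exact m x)) = 0 \<and>
       p x None \<le> (if i = m \<or> Exact_one (block m x i) then 0 else (2 / 3) ^ Suc N * 3 ^ (m - i))"
      if x: "length x = m\<^sup>2" and prev: "\<forall>i'<i. \<not> Exact_one (block m x i')" for x
    proof (cases "Exact_one (block m x i)")
      case True
      \<comment> \<open>The test never certifies a bad block, so the search stays here with
        certainty until the block is read.\<close>
      have "r x True + r x False = 1"
        using implementable_total[OF r x, of UNIV] by (simp add: UNIV_bool)
      then have "p x v = p0 x v" for v using rE[OF x True] by (simp add: p_def)
      then show ?thesis using p0x[OF x prev] True by simp
    next
      case E: False
      have prev': "\<forall>i'<Suc i. \<not> Exact_one (block m x i')" using prev E by (auto simp: less_Suc_eq)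
      \<comment> \<open>The bound tracks the expectation of 3 to the number of blocks left. A pass
        divides it by 3, a failure keeps it; with pass probability at least 1/2 a test multiplies it
        by at most \<open>1/2 * 1/3 + 1/2 = 2/3\<close>.\<close>
      define C :: real where "C = (2 / 3) ^ N * 3 ^ (m - Suc i)"
      have C: "0 \<le> C" by (simp add: C_def)
      have ms: "m - i = Suc (m - Suc i)" using i by simp
      have sum1: "r x False = 1 - r x True"
        using implementable_total[OF r x, of UNIV] by (simp add: UNIV_bool)
      have rb: "1 / 2 \<le> r x True" "0 \<le> r x False"
        using rN[OF x E] implementable_nonneg[OF r x] by auto
      have "p1 x None \<le> C" using p1x[OF x prev'] C unfolding C_def[symmetric] by (simp split: if_splits)
      moreover have "p0 x None \<le> 3 * C" using p0x[OF x prev] E i by (simp add: C_def ms)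
      ultimately have "p x None \<le> r x True * C + r x False * (3 * C)"
        unfolding p_def using rb by (intro add_mono mult_left_mono) auto
      also have "\<dots> = C * (3 - 2 * r x True)" unfolding sum1 by (simp add: algebra_simps)
      also have "\<dots> \<le> C * 2" using rb C by (intro mult_left_mono) auto
      also have "\<dots> = (2 / 3) ^ Suc N * 3 ^ (m - i)" by (simp add: C_def ms)
      finally show ?thesis using p0x[OF x prev] p1x[OF x prev'] E i by (simp add: p_def)
    qed
    ultimately show ?thesis by blast
  qed
qed

lemma Q_zero_error_bound:
  assumes m: "0 < m"
  shows "Q_zero_error (m\<^sup>2) (boolean_cube (m\<^sup>2)) (f_and_not_exact m) \<le> 5 * m * (4 * nat \<lceil>sqrt m\<rceil>) + m"
proof -
  obtain p where p: "implementable (m\<^sup>2) (5 * m * (4 * nat \<lceil>sqrt m\<rceil>) + m) p"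
    and px: "\<And>x. length x = m\<^sup>2 \<Longrightarrow> p x (Some (\<not> f_and_not_exact m x)) = 0 \<and>
       p x None \<le> (if 0 = m \<or> Exact_one (block m x 0) then 0 else (2 / 3) ^ (5 * m) * 3 ^ (m - 0))"
    using zero_error_search[OF m, of 0 "5 * m"] by auto
  obtain A where A: "query_algorithm_on (m\<^sup>2) A" "queries A = 5 * m * (4 * nat \<lceil>sqrt m\<rceil>) + m"
    "\<forall>x v. length x = m\<^sup>2 \<longrightarrow> output_prob (m\<^sup>2) A x v = p x v"
    using implementable_query_algorithm[OF _ p] m by auto
  \<comment> \<open>Five tests per block give the factor \<open>32/81\<close>, below 1/2; four would
    give only \<open>16/27\<close>.\<close>
  have "(2 / 3) ^ (5 * m) * 3 ^ m = ((2 / 3) ^ 5 * 3 :: real) ^ m"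
    by (simp add: power_mult power_mult_distrib)
  also have "\<dots> \<le> (1 / 2) ^ m" by (intro power_mono) (auto simp: power_divide)
  also have "\<dots> \<le> (1 / 2) ^ 1" using m by (intro power_decreasing) auto
  finally have half: "(2 / 3) ^ (5 * m) * 3 ^ m \<le> (1 / 2 :: real)" by simp
  have "p x None \<le> 1 / 2" if "length x = m\<^sup>2" for x
    using px[OF that] half by (auto split: if_splits)
  then have "computes_zero_error (m\<^sup>2) (boolean_cube (m\<^sup>2)) (f_and_not_exact m) A"
    using A(1,3) px by (auto simp: computes_zero_error_def boolean_cube_def)
  then show ?thesis unfolding Q_zero_error_def using A(2) by (intro Least_le) blast
qed

section \<open>The dual adversary algorithm\<close>

abbreviation nrm :: "nat \<Rightarrow> (nat \<Rightarrow> complex) \<Rightarrow> real" where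
  "nrm d \<psi> \<equiv> sqrt (nsq d \<psi>)"

lemma nrm_triangle: "nrm d (\<lambda>s. \<psi> s + \<phi> s) \<le> nrm d \<psi> + nrm d \<phi>"
proof -
  have "nrm d (\<lambda>s. \<psi> s + \<phi> s) = L2_set (\<lambda>s. cmod (\<psi> s + \<phi> s)) {..<d}"
    by (simp add: nsq_def L2_set_def)
  also have "\<dots> \<le> L2_set (\<lambda>s. cmod (\<psi> s) + cmod (\<phi> s)) {..<d}"
    by (intro L2_set_mono norm_triangle_ineq) auto
  also have "\<dots> \<le> L2_set (\<lambda>s. cmod (\<psi> s)) {..<d} + L2_set (\<lambda>s. cmod (\<phi> s)) {..<d}"
    by (rule L2_set_triangle_ineq)
  finally show ?thesis by (simp add: nsq_def L2_set_def)
qed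

lemma nrm_scale: "nrm d (\<lambda>s. c * \<psi> s) = cmod c * nrm d \<psi>"
  by (simp add: nsq_def norm_mult power_mult_distrib sum_distrib_left[symmetric] real_sqrt_mult)

lemma nrm_sum: "nrm d (\<lambda>s. \<Sum>t<(T::nat). \<psi> t s) \<le> (\<Sum>t<T. nrm d (\<psi> t))"
proof (induction T)
  case 0 show ?case by (simp add: nsq_def)
next
  case (Suc T)
  then show ?case using nrm_triangle[of d "\<lambda>s. \<Sum>t<T. \<psi> t s" "\<psi> T"] by simp
qed

section \<open>Sums along the orbit of a unitary\<close>

lemma unitary_funpow: "unitary_op d U \<Longrightarrow> unitary_op d (U ^^ t)"
proof (induction t)
  case 0 then show ?case using unitary_id by (simp add: id_def)
next
  case (Suc t) then show ?case using unitary_comp[of d U "U ^^ t"] by (simp add: comp_def)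
qed

lemma funpow_fixed:
  assumes "unitary_op d U" "\<And>s. s < d \<Longrightarrow> U z s = z s" "s < d"
  shows "(U ^^ t) z s = z s"
  using assms(3)
proof (induction t arbitrary: s)
  case (Suc t)
  have "U ((U ^^ t) z) s = U z s" by (rule unitary_local[OF assms(1) _ Suc.prems]) (rule Suc.IH)
  then show ?case using assms(2) Suc.prems by simp
qed simp

text \<open>The orbit sum of the fixed vector is \<open>T * z\<close>; replacing \<open>z\<close> by
  \<open>e\<close> changes it by at most \<open>T\<close> times the norm of
  \<open>z - e\<close>.\<close>

lemma orbit_sum_lower:
  assumes U: "unitary_op d U" and z: "\<And>s. s < d \<Longrightarrow> U z s = z s"
  shows "real T * (nrm d z - nrm d (\<lambda>s. z s - e s)) \<le> nrm d (\<lambda>s. \<Sum>t<T. (U ^^ t) e s)"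
proof -
  let ?g = "\<lambda>s. z s - e s"
  have "real T * nrm d z = nrm d (\<lambda>s. of_real T * z s)" by (simp add: nrm_scale)
  also have "\<dots> = nrm d (\<lambda>s. (\<Sum>t<T. (U ^^ t) e s) + (\<Sum>t<T. (U ^^ t) ?g s))"
  proof (intro arg_cong[where f = sqrt] nsq_cong)
    fix s assume s: "s < d"
    have "(U ^^ t) e s + (U ^^ t) ?g s = z s" for t
      using linear_diff[OF unitary_linear[OF unitary_funpow[OF U]], of t z e]
        funpow_fixed[OF U z s, of t] by simp
    then show "of_real T * z s = (\<Sum>t<T. (U ^^ t) e s) + (\<Sum>t<T. (U ^^ t) ?g s)"
      by (simp add: sum.distrib[symmetric])
  qed
  also have "\<dots> \<le> nrm d (\<lambda>s. \<Sum>t<T. (U ^^ t) e s) + nrm d (\<lambda>s. \<Sum>t<T. (U ^^ t) ?g s)"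
    by (rule nrm_triangle)
  also have "nrm d (\<lambda>s. \<Sum>t<T. (U ^^ t) ?g s) \<le> (\<Sum>t<T. nrm d ((U ^^ t) ?g))"
    by (rule nrm_sum)
  also have "\<dots> = real T * nrm d ?g" by (simp add: unitary_nsq[OF unitary_funpow[OF U]])
  finally show ?thesis by (simp add: algebra_simps)
qed

text \<open>Only \<open>w / 2\<close> and \<open>- (U ^^ T) w / 2\<close> survive the telescoping,
  and both have half the norm of \<open>w\<close>, independently of \<open>T\<close>.\<close>

lemma orbit_sum_upper:
  assumes U: "unitary_op d U" and w: "\<And>s. s < d \<Longrightarrow> U w s = w s - 2 * e s"
  shows "nrm d (\<lambda>s. \<Sum>t<T. (U ^^ t) e s) \<le> nrm d w"
proof -
  have lin: "linear_op (U ^^ t)" for t by (rule unitary_linear[OF unitary_funpow[OF U]])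
  have tel: "(\<Sum>t<T. (U ^^ t) e s) = 1 / 2 * w s + - 1 / 2 * (U ^^ T) w s" if s: "s < d" for s
  proof (induction T)
    case (Suc T)
    have "(U ^^ Suc T) w s = (U ^^ T) (U w) s" by (simp only: funpow_Suc_right comp_apply)
    also have "\<dots> = (U ^^ T) (\<lambda>s. w s - 2 * e s) s"
      by (rule unitary_local[OF unitary_funpow[OF U] w s])
    also have "\<dots> = (U ^^ T) w s - 2 * (U ^^ T) e s"
      using linear_diff[OF lin, of T w "\<lambda>s. 2 * e s"] linear_scale[OF lin, of T 2 e] by simp
    finally show ?case using Suc by (simp add: diff_divide_distrib)
  qed simp
  have "nrm d (\<lambda>s. \<Sum>t<T. (U ^^ t) e s) = nrm d (\<lambda>s. 1 / 2 * w s + - 1 / 2 * (U ^^ T) w s)"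
    by (intro arg_cong[where f = sqrt] nsq_cong tel)
  also have "\<dots> \<le> nrm d (\<lambda>s. 1 / 2 * w s) + nrm d (\<lambda>s. - 1 / 2 * (U ^^ T) w s)" by (rule nrm_triangle)
  also have "\<dots> = nrm d w"
    unfolding nrm_scale by (simp add: unitary_nsq[OF unitary_funpow[OF U]])
  finally show ?thesis .
qed

text \<open>The first register holds a counter \<open>t < T\<close> in uniform superposition and controls the power
  of the iteration; at the end it is tested for being uniform again.\<close>

lemma orbit_average_implementable:
  fixes R :: "(nat \<Rightarrow> complex) \<Rightarrow> nat \<Rightarrow> complex" and q :: "nat \<Rightarrow> nat option" and \<sigma> :: "nat \<Rightarrow> complex"
  assumes R: "unitary_op d R" and q: "\<And>s. set_option (q s) \<subseteq> {..<n}" and \<sigma>: "\<And>s. cmod (\<sigma> s) = 1"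
    and d: "0 < d" and T: "0 < T"
  defines "U \<equiv> \<lambda>x \<psi> s. \<sigma> s * (phase x (q s) * R \<psi> s)"
  shows "\<exists>p. implementable n T p \<and>
    (\<forall>x. length x = n \<longrightarrow> p x True = nsq d (\<lambda>s. \<Sum>t<T. (U x ^^ t) (delta 0) s) / (real T)\<^sup>2)"
proof -
  define h :: complex where "h = of_real (1 / sqrt T)"
  have hh: "h * h = 1 / of_nat T" unfolding h_def using T by (simp flip: of_real_mult add: real_sqrt_mult_self)
  have ch: "cnj h = h" by (simp add: h_def)
  have h2: "(cmod h)\<^sup>2 = 1 / real T" unfolding h_def using T by (simp add: norm_divide power_divide)
  let ?W = "T * d"
  let ?v = "\<lambda>k. h * delta 0 (k mod d)"
  have "nsq ?W ?v = (\<Sum>t<T. (cmod h)\<^sup>2 * nsq d (delta 0))"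
    unfolding nsq_def sum_div_mod sum_distrib_left
    by (intro sum.cong refl) (simp add: norm_mult power_mult_distrib)
  then have nv: "nsq ?W ?v = 1" using T by (simp add: nsq_delta[OF d] h2)
  have i1: "ip ?W (delta 0) (delta 0) = ip ?W ?v ?v" using T d by (simp add: ip_self nv nsq_delta)
  have "ip ?W (delta 0) ?v = h" using T d by (simp add: ip_delta delta_def)
  then have i2: "ip ?W (delta 0) ?v = ip ?W ?v (delta 0)"
    using cnj_ip[of ?W "delta 0" ?v] ch by simp
  obtain G where G: "unitary_op ?W G" "\<And>k. k < ?W \<Longrightarrow> G (delta 0) k = ?v k"
    by (rule swap_exists[OF i1 i2]) blast
  let ?u = "\<lambda>t::nat. h"
  have "nsq T ?u = 1" using T by (simp add: nsq_def h2)
  then have j1: "ip T (delta 0) (delta 0) = ip T ?u ?u"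
    by (simp add: ip_self nsq_delta[OF T])
  have "ip T (delta 0) ?u = h" using T by (simp add: ip_delta)
  then have j2: "ip T (delta 0) ?u = ip T ?u (delta 0)" using cnj_ip[of T "delta 0" ?u] ch by simp
  obtain H where H: "unitary_op T H" "\<And>t. t < T \<Longrightarrow> H ?u t = delta 0 t"
    by (rule swap_exists[OF j1 j2]) blast
  \<comment> \<open>\<open>H\<close> sends the uniform vector to \<open>delta 0\<close>, so the
    amplitude at 0 is the inner product with the uniform vector.\<close>
  have H0: "H \<phi> 0 = (\<Sum>t<T. h * \<phi> t)" for \<phi>
  proof -
    have "H \<phi> 0 = ip T (H ?u) (H \<phi>)" using T ip_delta[OF T, of "H \<phi>"] ip_cong[of T "H ?u" "delta 0"] H(2) by simp
    also have "\<dots> = ip T ?u \<phi>" by (rule unitary_ip[OF H(1)])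
    finally show ?thesis by (simp add: ip_def ch)
  qed
  \<comment> \<open>After \<open>r\<close> rounds, counter value \<open>t\<close> has received
    \<open>min r t\<close> iterations. All counters are below \<open>T\<close>, so \<open>T\<close>
    rounds complete every power.\<close>
  define S where "S = (\<lambda>r x k. h * (U x ^^ min r (k div d)) (delta 0) (k mod d))"
  have reach: "reach n ?W r (S r)" for r
  proof (induction r)
    case 0
    show ?case
      by (rule reach_cong[OF reach_gate[OF reach_delta G(1)]]) (simp add: G(2) S_def)
  next
    case (Suc r)
    let ?R = "ctl_op d (\<lambda>t. if r < t then R else (\<lambda>\<psi>. \<psi>))"
    let ?q = "\<lambda>k. if r < k div d then q (k mod d) else None"
    let ?c = "\<lambda>k. if r < k div d then \<sigma> (k mod d) else 1"
    have uR: "unitary_op ?W ?R" by (rule unitary_ctl) (simp add: R unitary_id)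
    have uD: "unitary_op ?W (\<lambda>\<psi> k. ?c k * \<psi> k)" by (rule unitary_diag) (simp add: \<sigma>)
    have "reach n ?W (Suc r) (\<lambda>x k. phase x (?q k) * ?R (S r x) k)"
      by (rule reach_query[OF reach_gate[OF Suc uR]]) (use q in simp)
    then have "reach n ?W (Suc r) (\<lambda>x k. ?c k * (phase x (?q k) * ?R (S r x) k))"
      by (rule reach_gate[OF _ uD])
    then show ?case
    proof (rule reach_cong)
      fix x :: "bool list" and k assume k: "k < ?W"
      show "S (Suc r) x k = ?c k * (phase x (?q k) * ?R (S r x) k)"
      proof (cases "r < k div d")
        case True
        have "R (\<lambda>e. S r x (k div d * d + e)) (k mod d) = R (\<lambda>e. h * (U x ^^ r) (delta 0) e) (k mod d)"
          by (rule unitary_local[OF R]) (use True d in \<open>simp_all add: S_def\<close>)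
        also have "\<dots> = h * R ((U x ^^ r) (delta 0)) (k mod d)"
          by (subst linear_scale[OF unitary_linear[OF R]]) simp
        finally have "?R (S r x) k = h * R ((U x ^^ r) (delta 0)) (k mod d)"
          using True by (simp add: ctl_op_def)
        then show ?thesis using True by (simp add: S_def U_def min_def)
      next
        case False
        have "?R (S r x) k = S r x k" using False by (simp add: ctl_op_def)
        then show ?thesis using False by (simp add: S_def min_def)
      qed
    qed
  qed
  let ?F = "\<lambda>x. lift_op d H (S T x)"
  define p where "p = (\<lambda>x b. \<Sum>k | k < ?W \<and> (k div d = 0) = b. (cmod (?F x k))\<^sup>2)"
  have "implementable n T p"
    by (rule implementableI[OF _ reach_gate[OF reach unitary_lift[OF H(1)]], where out = "\<lambda>k. k div d = 0"])
      (use T d in \<open>simp_all add: p_def\<close>)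
  moreover have "p x True = nsq d (\<lambda>s. \<Sum>t<T. (U x ^^ t) (delta 0) s) / (real T)\<^sup>2" for x
  proof -
    have F: "?F x (0 * d + s) = 1 / of_nat T * (\<Sum>t<T. (U x ^^ t) (delta 0) s)" if "s < d" for s
    proof -
      have "?F x (0 * d + s) = H (\<lambda>w. S T x (w * d + s)) 0" using that by (simp add: lift_op_def)
      also have "\<dots> = (\<Sum>t<T. (h * h) * (U x ^^ t) (delta 0) s)"
        unfolding H0 using that by (intro sum.cong refl) (simp add: S_def)
      finally show ?thesis unfolding hh sum_distrib_left .
    qed
    have "p x True = (\<Sum>w<T. \<Sum>s<d. if w = 0 then (cmod (?F x (0 * d + s)))\<^sup>2 else 0)"
      unfolding p_def sum_less_filter sum_div_mod by (intro sum.cong refl) auto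
    also have "\<dots> = (\<Sum>w<T. if w = 0 then (\<Sum>s<d. (cmod (?F x (0 * d + s)))\<^sup>2) else 0)"
      by (intro sum.cong) auto
    also have "\<dots> = (\<Sum>s<d. (cmod (?F x (0 * d + s)))\<^sup>2)" using T by simp
    also have "\<dots> = (\<Sum>s<d. (cmod (1 / of_nat T * (\<Sum>t<T. (U x ^^ t) (delta 0) s)))\<^sup>2)"
      by (intro sum.cong refl) (simp only: F lessThan_iff)
    also have "\<dots> = (\<Sum>s<d. (cmod (\<Sum>t<T. (U x ^^ t) (delta 0) s))\<^sup>2 / (real T)\<^sup>2)"
      unfolding norm_mult power_mult_distrib by (simp add: norm_divide power_divide)
    finally show ?thesis unfolding nsq_def sum_divide_distrib .
  qed
  ultimately show ?thesis by (intro exI[of _ p]) simp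
qed


text \<open>Labels are in mixed radix, \<open>k = (l * 2 + b) * C + c\<close>.\<close>

lemma sum_digits:
  fixes F :: "nat \<Rightarrow> nat \<Rightarrow> nat \<Rightarrow> 'a :: comm_monoid_add"
  shows "(\<Sum>k<L * 2 * C. F (k div C div 2) (k div C mod 2) (k mod C)) =
    (\<Sum>l<L. \<Sum>c<C. F l 0 c + F l 1 c)"
proof -
  have s2: "(\<Sum>b<2. f b) = f 0 + f 1" for f :: "nat \<Rightarrow> 'a" by (simp add: numeral_2_eq_2)
  have "(\<Sum>k<L * 2 * C. F (k div C div 2) (k div C mod 2) (k mod C)) =
      (\<Sum>a<L * 2. \<Sum>c<C. F (a div 2) (a mod 2) c)"
    unfolding sum_div_mod by (intro sum.cong refl) auto
  also have "\<dots> = (\<Sum>l<L. \<Sum>b<2. \<Sum>c<C. F l b c)"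
    unfolding sum_div_mod by (intro sum.cong refl) auto
  finally show ?thesis by (simp only: s2 sum.distrib)
qed

text \<open>The dual of the general adversary bound yields a bounded-error algorithm. Label \<open>0\<close> is the
  start state \<open>e\<close>; the labels \<open>(l, b, c)\<close> carry a query index, a bit and a coordinate of the vectors.
  With \<open>z\<close> and \<open>w\<close> as in the proof, the span of all \<open>z x\<close> is orthogonal to all \<open>w y\<close>. The reflection
  about this span followed by the query phase fixes \<open>z x\<close>, which is close to \<open>e\<close>, and maps
  \<open>w y\<close> to \<open>w y - 2 e\<close>.\<close>

theorem dual_adversary_algorithm:
  fixes u v :: "bool list \<Rightarrow> nat \<Rightarrow> nat \<Rightarrow> real" and A B :: real
  assumes n: "0 < n" and A: "0 < A"
    and u: "\<And>x. length x = n \<Longrightarrow> f x \<Longrightarrow> (\<Sum>l<n. \<Sum>c<C. (u x l c)\<^sup>2) \<le> A"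
    and v: "\<And>y. length y = n \<Longrightarrow> \<not> f y \<Longrightarrow> (\<Sum>l<n. \<Sum>c<C. (v y l c)\<^sup>2) \<le> B"
    and uv: "\<And>x y. length x = n \<Longrightarrow> length y = n \<Longrightarrow> f x \<Longrightarrow> \<not> f y \<Longrightarrow>
      (\<Sum>l<n. if x ! l \<noteq> y ! l then \<Sum>c<C. u x l c * v y l c else 0) = 1"
    and T: "0 < T" "3 * (1 + 100 * A * B) \<le> (real T)\<^sup>2"
  shows "\<exists>A. computes_bounded_error n (boolean_cube n) f A \<and> queries A = T"
proof -
  \<comment> \<open>The scaling is inverse in \<open>z\<close> and \<open>w\<close>, which keeps
    their products. It puts \<open>z\<close> within 1/10 of the start state, at the price of the
    factor \<open>100 * A\<close> in the squared norm of \<open>w\<close>.\<close>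
  define \<epsilon> where "\<epsilon> = 1 / (10 * sqrt A)"
  have \<epsilon>0: "\<epsilon> \<noteq> 0" using A by (simp add: \<epsilon>_def)
  have \<epsilon>2: "\<epsilon>\<^sup>2 = 1 / (100 * A)" using A by (simp add: \<epsilon>_def power_divide power_mult_distrib)
  define M where "M = n * 2 * C"
  \<comment> \<open>\<open>z x\<close> lives where the bit \<open>b\<close> agrees with
    \<open>x ! l\<close>, \<open>w y\<close> where it disagrees with \<open>y ! l\<close>. They meet
    exactly at the \<open>l\<close> where \<open>x\<close> and \<open>y\<close> differ, which
    restricts the inner product to those \<open>l\<close>.\<close>
  define \<rho> where "\<rho> = (\<lambda>(x::bool list) l b. ((b::nat) = 1) = x ! l)"
  define zr where "zr = (\<lambda>x l b c. if \<rho> x l b then \<epsilon> * u x l c else 0)"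
  define wr where "wr = (\<lambda>y l b c. if \<rho> y l b then 0 else - (v y l c / \<epsilon>))"
  define vec_of :: "(nat \<Rightarrow> nat \<Rightarrow> nat \<Rightarrow> real) \<Rightarrow> nat \<Rightarrow> complex" where
    "vec_of = (\<lambda>F s. case s of 0 \<Rightarrow> 1 | Suc k \<Rightarrow> of_real (F (k div C div 2) (k div C mod 2) (k mod C)))"
  define z where "z = (\<lambda>x. vec_of (zr x))"
  define w where "w = (\<lambda>y. vec_of (wr y))"
  define q where "q = (\<lambda>s. case s of 0 \<Rightarrow> None | Suc k \<Rightarrow> if k div C div 2 < n then Some (k div C div 2) else None)"
  \<comment> \<open>Together with the query sign this gives 1 where \<open>b\<close> agrees with the
    input bit and -1 where it does not.\<close>
  define \<sigma> :: "nat \<Rightarrow> complex" where "\<sigma> = (\<lambda>s. case s of 0 \<Rightarrow> 1 | Suc k \<Rightarrow> if k div C mod 2 = 1 then - 1 else 1)"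
  have ip_vec: "ip (Suc M) (vec_of F) (vec_of G) = of_real (1 + (\<Sum>l<n. \<Sum>c<C. F l 0 c * G l 0 c + F l 1 c * G l 1 c))"
    for F G
  proof -
    have "ip (Suc M) (vec_of F) (vec_of G) = of_real (1 + (\<Sum>k<M. F (k div C div 2) (k div C mod 2) (k mod C) *
        G (k div C div 2) (k div C mod 2) (k mod C)))"
      unfolding ip_def sum.lessThan_Suc_shift by (simp add: vec_of_def)
    then show ?thesis unfolding M_def using sum_digits[of "\<lambda>l b c. F l b c * G l b c" C n] by simp
  qed
  have nsq_vec: "nsq (Suc M) (vec_of F) = 1 + (\<Sum>l<n. \<Sum>c<C. (F l 0 c)\<^sup>2 + (F l 1 c)\<^sup>2)" for F
    using ip_vec[of F F] unfolding ip_self of_real_eq_iff by (simp add: power2_eq_square)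
  have nz: "1 \<le> nsq (Suc M) (z x)" "nsq (Suc M) (z x) \<le> 1 + 1 / 100" if "length x = n" "f x" for x
  proof -
    have "(\<Sum>l<n. \<Sum>c<C. (zr x l 0 c)\<^sup>2 + (zr x l 1 c)\<^sup>2) = \<epsilon>\<^sup>2 * (\<Sum>l<n. \<Sum>c<C. (u x l c)\<^sup>2)"
      unfolding sum_distrib_left by (intro sum.cong refl) (simp add: zr_def \<rho>_def power_mult_distrib)
    also have "\<dots> \<le> \<epsilon>\<^sup>2 * A" by (intro mult_left_mono u that) simp
    also have "\<dots> = 1 / 100" using A by (simp add: \<epsilon>2)
    finally show "nsq (Suc M) (z x) \<le> 1 + 1 / 100" by (simp add: z_def nsq_vec)
    show "1 \<le> nsq (Suc M) (z x)" by (simp add: z_def nsq_vec sum_nonneg)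
  qed
  have nw: "nsq (Suc M) (w y) \<le> 1 + 100 * A * B" if "length y = n" "\<not> f y" for y
  proof -
    have "(\<Sum>l<n. \<Sum>c<C. (wr y l 0 c)\<^sup>2 + (wr y l 1 c)\<^sup>2) = 1 / \<epsilon>\<^sup>2 * (\<Sum>l<n. \<Sum>c<C. (v y l c)\<^sup>2)"
      unfolding sum_distrib_left by (intro sum.cong refl) (simp add: wr_def \<rho>_def power_divide)
    also have "\<dots> \<le> 1 / \<epsilon>\<^sup>2 * B" by (intro mult_left_mono v that) simp
    also have "\<dots> = 100 * A * B" by (simp add: \<epsilon>2)
    finally show ?thesis by (simp add: w_def nsq_vec)
  qed
  have orth: "ip (Suc M) (z x) (w y) = 0" if "length x = n" "f x" "length y = n" "\<not> f y" for x y
  proof -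
    have "(\<Sum>l<n. \<Sum>c<C. zr x l 0 c * wr y l 0 c + zr x l 1 c * wr y l 1 c) =
        (\<Sum>l<n. - (if x ! l \<noteq> y ! l then \<Sum>c<C. u x l c * v y l c else 0))"
    proof (rule sum.cong[OF refl])
      fix l
      have "zr x l 0 c * wr y l 0 c + zr x l 1 c * wr y l 1 c = (if x ! l \<noteq> y ! l then - (u x l c * v y l c) else 0)" for c
        using \<epsilon>0 by (cases "x ! l"; cases "y ! l") (simp_all add: zr_def wr_def \<rho>_def)
      then show "(\<Sum>c<C. zr x l 0 c * wr y l 0 c + zr x l 1 c * wr y l 1 c) =
          - (if x ! l \<noteq> y ! l then \<Sum>c<C. u x l c * v y l c else 0)"
        by (simp add: sum_negf)
    qed
    also have "\<dots> = - 1" unfolding sum_negf using uv[OF that(1,3,2,4)] by simp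
    finally show ?thesis unfolding z_def w_def ip_vec by simp
  qed
  have "finite {x :: bool list. length x = n}" using finite_lists_length_eq[of "UNIV :: bool set" n] by simp
  then have fin: "finite (z ` {x. length x = n \<and> f x})" by (intro finite_imageI) (rule finite_subset, auto)
  \<comment> \<open>The span is taken over all accepted inputs at once, since this gate must not
    depend on the input.\<close>
  obtain R where R: "unitary_op (Suc M) R"
    and Rz: "\<And>\<psi> s. \<psi> \<in> z ` {x. length x = n \<and> f x} \<Longrightarrow> s < Suc M \<Longrightarrow> R \<psi> s = \<psi> s"
    and Ro: "\<And>\<psi> s. \<forall>\<phi>\<in>z ` {x. length x = n \<and> f x}. ip (Suc M) \<phi> \<psi> = 0 \<Longrightarrow> R \<psi> s = - \<psi> s"
    by (rule reflection_exists[OF fin]) blast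
  define U where "U = (\<lambda>x \<psi> s. \<sigma> s * (phase x (q s) * R \<psi> s))"
  have q: "set_option (q s) \<subseteq> {..<n}" for s by (simp add: q_def split: nat.split)
  have \<sigma>: "cmod (\<sigma> s) = 1" for s by (simp add: \<sigma>_def split: nat.split)
  have UU: "unitary_op (Suc M) (U x)" for x
  proof -
    have "unitary_op (Suc M) (\<lambda>\<psi> s. (\<sigma> s * phase x (q s)) * \<psi> s)"
      by (rule unitary_diag) (simp add: norm_mult \<sigma> cmod_phase)
    from unitary_comp[OF this R] show ?thesis by (simp add: U_def mult.assoc)
  qed
  have ph: "\<sigma> 0 * phase x (q 0) = 1" "k < M \<Longrightarrow> \<sigma> (Suc k) * phase x (q (Suc k)) =
      (if \<rho> x (k div C div 2) (k div C mod 2) then 1 else - 1)" for x k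
  proof -
    assume "k < M"
    then have "k div C < n * 2" unfolding M_def by (rule div_mod_lt(1))
    then have "k div C div 2 < n" by (rule div_mod_lt(1))
    then show "\<sigma> (Suc k) * phase x (q (Suc k)) = (if \<rho> x (k div C div 2) (k div C mod 2) then 1 else - 1)"
      by (simp add: \<sigma>_def q_def \<rho>_def)
  qed (simp add: \<sigma>_def q_def)
  have Uz: "U x (z x) s = z x s" if "length x = n" "f x" "s < Suc M" for x s
  proof -
    have "U x (z x) s = \<sigma> s * phase x (q s) * z x s" using Rz[of "z x" s] that by (simp add: U_def)
    also have "\<dots> = z x s"
    proof (cases s)
      case 0 then show ?thesis using ph(1) by simp
    next
      case (Suc k)
      then have "k < M" using that by simp
      then show ?thesis unfolding Suc ph(2)[OF \<open>k < M\<close>] by (simp add: z_def vec_of_def zr_def)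
    qed
    finally show ?thesis .
  qed
  have Uw: "U y (w y) s = w y s - 2 * delta 0 s" if "length y = n" "\<not> f y" "s < Suc M" for y s
  proof -
    \<comment> \<open>The sign factor then undoes this negation on the whole support of
      \<open>w y\<close> except at label 0, where 1 has become \<open>-1 = 1 - 2\<close>.\<close>
    have "R (w y) s = - w y s" by (rule Ro) (use orth that in auto)
    then have "U y (w y) s = - (\<sigma> s * phase y (q s) * w y s)" by (simp add: U_def)
    also have "\<dots> = w y s - 2 * delta 0 s"
    proof (cases s)
      case 0 then show ?thesis using ph(1) by (simp add: delta_def w_def vec_of_def)
    next
      case (Suc k)
      then have "k < M" using that by simp
      then show ?thesis unfolding Suc ph(2)[OF \<open>k < M\<close>] by (simp add: w_def vec_of_def wr_def delta_def)
    qed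
    finally show ?thesis .
  qed
  have "\<exists>p. implementable n T p \<and> (\<forall>x. length x = n \<longrightarrow>
      p x True = nsq (Suc M) (\<lambda>s. \<Sum>t<T. (U x ^^ t) (delta 0) s) / (real T)\<^sup>2)"
    unfolding U_def by (rule orbit_average_implementable[OF R q \<sigma> _ T(1)]) simp
  then obtain p where p': "implementable n T p \<and> (\<forall>x. length x = n \<longrightarrow>
      p x True = nsq (Suc M) (\<lambda>s. \<Sum>t<T. (U x ^^ t) (delta 0) s) / (real T)\<^sup>2)" ..
  note p = conjunct1[OF p'] and px = conjunct2[OF p', rule_format]
  have pos: "2 / 3 \<le> p x True" if x: "length x = n" "f x" for x
  proof -
    let ?S = "\<lambda>s. \<Sum>t<T. (U x ^^ t) (delta 0) s"
    have "nsq (Suc M) (\<lambda>s. z x s - delta 0 s) = nsq (Suc M) (z x) - 1"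
      unfolding nsq_def sum.lessThan_Suc_shift by (simp add: z_def vec_of_def delta_def)
    then have "nrm (Suc M) (\<lambda>s. z x s - delta 0 s) \<le> sqrt ((1 / 10)\<^sup>2)"
      using nz(2)[OF x] by (intro real_sqrt_le_mono) (simp add: power2_eq_square)
    moreover have "1 \<le> nrm (Suc M) (z x)" using nz(1)[OF x] by simp
    moreover have "sqrt ((1 / 10)\<^sup>2) = (1 / 10 :: real)" by simp
    ultimately have "9 / 10 \<le> nrm (Suc M) (z x) - nrm (Suc M) (\<lambda>s. z x s - delta 0 s)" by linarith
    then have "real T * (9 / 10) \<le> real T * (nrm (Suc M) (z x) - nrm (Suc M) (\<lambda>s. z x s - delta 0 s))"
      by (rule mult_left_mono) simp
    also have "\<dots> \<le> nrm (Suc M) ?S" by (rule orbit_sum_lower[OF UU]) (rule Uz[OF x])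
    finally have "(real T * (9 / 10))\<^sup>2 \<le> (nrm (Suc M) ?S)\<^sup>2" by (intro power_mono) auto
    then have "(real T)\<^sup>2 * (81 / 100) \<le> nsq (Suc M) ?S" by (simp add: nsq_nonneg power_mult_distrib power_divide)
    then have "81 / 100 \<le> p x True" using T(1) by (simp add: px[OF x(1)] field_simps)
    then show ?thesis by simp
  qed
  have neg: "p x True \<le> 1 / 3" if x: "length x = n" "\<not> f x" for x
  proof -
    let ?S = "\<lambda>s. \<Sum>t<T. (U x ^^ t) (delta 0) s"
    have "nrm (Suc M) ?S \<le> nrm (Suc M) (w x)" by (rule orbit_sum_upper[OF UU]) (rule Uw[OF x])
    then have "nsq (Suc M) ?S \<le> nsq (Suc M) (w x)" by simp
    also have "\<dots> \<le> 1 + 100 * A * B" by (rule nw[OF x])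
    also have "\<dots> \<le> (real T)\<^sup>2 / 3" using T(2) by simp
    finally show ?thesis using T(1) by (simp add: px[OF x(1)] field_simps)
  qed
  obtain \<A> where \<A>': "query_algorithm_on n \<A> \<and> queries \<A> = T \<and>
      (\<forall>x v. length x = n \<longrightarrow> output_prob n \<A> x v = p x v)"
    using implementable_query_algorithm[OF n p] ..
  note \<A> = conjunct1[OF \<A>'] conjunct1[OF conjunct2[OF \<A>']] conjunct2[OF conjunct2[OF \<A>'], rule_format]
  have "2 / 3 \<le> output_prob n \<A> x (f x)" if x: "length x = n" for x
  proof (cases "f x")
    case True
    then show ?thesis using pos[OF x] by (simp add: \<A>(3)[OF x])
  next
    case False
    have "p x True + p x False = 1" using implementable_total[OF p x, of UNIV] by (simp add: UNIV_bool)
    then show ?thesis using neg[OF x False] False by (simp add: \<A>(3)[OF x])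
  qed
  then have "computes_bounded_error n (boolean_cube n) f \<A>"
    using \<A>(1) by (simp add: computes_bounded_error_def boolean_cube_def)
  with \<A>(2) show ?thesis by blast
qed

section \<open>Dual adversary vectors for the function\<close>

abbreviation ind :: "bool \<Rightarrow> real" where
  "ind \<equiv> of_bool"

text \<open>The pair depends on \<open>M\<close> alone: the vectors of an accepted input may not
  refer to the rejected input that they are paired with.\<close>

definition two_of :: "nat set \<Rightarrow> nat \<times> nat" where
  "two_of M = (SOME (p, q). p \<in> M \<and> q \<in> M \<and> p \<noteq> q)"

lemma two_of:
  assumes "finite M" "M \<noteq> {}" "card M \<noteq> 1"
  obtains p q where "two_of M = (p, q)" "p \<in> M" "q \<in> M" "p \<noteq> q"
proof -
  obtain p where "p \<in> M" using assms(2) by blast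
  moreover have "M \<noteq> {p}" using assms(3) by auto
  ultimately obtain q where "q \<in> M" "p \<noteq> q" by blast
  with \<open>p \<in> M\<close> have "case (p, q) of (p, q) \<Rightarrow> p \<in> M \<and> q \<in> M \<and> p \<noteq> q" by simp
  then have "case two_of M of (p, q) \<Rightarrow> p \<in> M \<and> q \<in> M \<and> p \<noteq> q"
    unfolding two_of_def by (rule someI)
  then show ?thesis using that by (cases "two_of M") auto
qed

text \<open>Dual adversary vectors for a block of \<open>m\<close> bits with set of ones \<open>M\<close>: the first family is used
  for \<open>card M \<noteq> 1\<close>, the second one for \<open>M = {k}\<close>. The coordinates \<open>c < m\<close> stand for positions,
  \<open>m\<close> is a common coordinate, and \<open>m + 1\<close> separates the zero block from \<open>{k}\<close>.
  A block with two chosen ones \<open>p\<close> and \<open>q\<close> differs from \<open>{k}\<close> at both of them or, if \<open>k\<close> is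
  one of them, at the other one only; the inner products are 1/2 in the first case and 1 in the second.\<close>

definition block_vec0 :: "nat \<Rightarrow> nat set \<Rightarrow> nat \<Rightarrow> nat \<Rightarrow> real" where
  "block_vec0 m M j c =
     (if M = {} then ind (c = m + 1) / sqrt m
      else case two_of M of (p, q) \<Rightarrow>
        ind (j = p) * (ind (c = m) + ind (c = q)) / 2 + ind (j = q) * (ind (c = m) + ind (c = p)) / 2)"

definition block_vec1 :: "nat \<Rightarrow> nat \<Rightarrow> nat \<Rightarrow> nat \<Rightarrow> real" where
  "block_vec1 m k j c =
     (if j = k then ind (c = m + 1) * sqrt m else ind (c = m) + ind (c = k))"

lemma sum_ind: "b < N \<Longrightarrow> (\<Sum>c<N. ind (c = b) * g c) = g (b :: nat)"
  by (simp add: of_bool_def if_distrib[of "\<lambda>t. t * _"] cong: if_cong)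

lemma sum_block_vec0_empty:
  "(\<Sum>c<m + 2. block_vec0 m {} j c * g c) = g (m + 1) / sqrt m"
proof -
  have "(\<Sum>c<m + 2. block_vec0 m {} j c * g c) = (\<Sum>c<m + 2. ind (c = m + 1) * (g c / sqrt m))"
    by (intro sum.cong refl) (simp add: block_vec0_def)
  then show ?thesis by (simp add: sum_ind)
qed

lemma sum_block_vec0:
  assumes "two_of M = (p, q)" "M \<noteq> {}" "p < m" "q < m"
  shows "(\<Sum>c<m + 2. block_vec0 m M j c * g c) =
    ind (j = p) * (g m + g q) / 2 + ind (j = q) * (g m + g p) / 2"
proof -
  have "(\<Sum>c<m + 2. block_vec0 m M j c * g c) = (\<Sum>c<m + 2. ind (j = p) / 2 * (ind (c = m) * g c) +
      ind (j = p) / 2 * (ind (c = q) * g c) + ind (j = q) / 2 * (ind (c = m) * g c) + ind (j = q) / 2 * (ind (c = p) * g c))"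
    by (intro sum.cong refl) (simp add: block_vec0_def assms(1,2) algebra_simps)
  also have "\<dots> = ind (j = p) / 2 * g m + ind (j = p) / 2 * g q + ind (j = q) / 2 * g m + ind (j = q) / 2 * g p"
    unfolding sum.distrib sum_distrib_left[symmetric] using assms(3,4) by (simp add: sum_ind)
  finally show ?thesis by (simp add: algebra_simps)
qed

text \<open>The zero block has weight \<open>1 / m\<close> at each of the \<open>m\<close>
  positions; every other block has two entries 1/2 at each of its two chosen ones.\<close>

lemma block_vec0_size:
  assumes "0 < m" "M \<subseteq> {..<m}" "card M \<noteq> 1"
  shows "(\<Sum>j<m. \<Sum>c<m + 2. (block_vec0 m M j c)\<^sup>2) = 1"
proof (cases "M = {}")
  case True
  have "(\<Sum>c<m + 2. (block_vec0 m M j c)\<^sup>2) = 1 / m" for j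
    unfolding True power2_eq_square sum_block_vec0_empty
    using assms(1) by (simp add: block_vec0_def)
  then show ?thesis using assms(1) by simp
next
  case False
  obtain p q where pq: "two_of M = (p, q)" "p \<in> M" "q \<in> M" "p \<noteq> q"
    by (rule two_of[OF finite_subset[OF assms(2)] False assms(3)]) auto
  then have lt: "p < m" "q < m" using assms(2) by auto
  have "(\<Sum>c<m + 2. (block_vec0 m M j c)\<^sup>2) = ind (j = p) * (1 / 2) + ind (j = q) * (1 / 2)" for j
    unfolding power2_eq_square sum_block_vec0[OF pq(1) False lt]
    using False pq lt by (auto simp: block_vec0_def)
  then show ?thesis using lt by (simp add: sum.distrib sum_ind[where g = "\<lambda>_. 1 / 2"] del: times_divide_eq_right)
qed

text \<open>Position \<open>k\<close> contributes \<open>m\<close>, which compensates the small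
  entries \<open>1 / sqrt m\<close> of the zero block; every other position contributes 2.\<close>

lemma block_vec1_size:
  assumes "k < m"
  shows "(\<Sum>j<m. \<Sum>c<m + 2. (block_vec1 m k j c)\<^sup>2) \<le> 3 * m"
proof -
  have "(\<Sum>c<m + 2. (block_vec1 m k j c)\<^sup>2) \<le> ind (j = k) * m + 2" for j
  proof (cases "j = k")
    case True
    have "(\<Sum>c<m + 2. (block_vec1 m k j c)\<^sup>2) = (\<Sum>c<m + 2. ind (c = m + 1) * real m)"
      by (intro sum.cong refl) (simp add: block_vec1_def True power_mult_distrib)
    then show ?thesis using True by (simp add: sum_ind[where g = "\<lambda>_. real m"])
  next
    case False
    have "(\<Sum>c<m + 2. (block_vec1 m k j c)\<^sup>2) = (\<Sum>c<m + 2. ind (c = m) * 1 + ind (c = k) * 1)"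
      using assms by (intro sum.cong refl) (auto simp: block_vec1_def False)
    also have "\<dots> = 2" unfolding sum.distrib using assms by (simp add: sum_ind[where g = "\<lambda>_. 1"] del: mult_1_right)
    finally show ?thesis using False by simp
  qed
  then have "(\<Sum>j<m. \<Sum>c<m + 2. (block_vec1 m k j c)\<^sup>2) \<le> (\<Sum>j<m. ind (j = k) * m + 2)"
    by (intro sum_mono)
  also have "\<dots> = 3 * m" using assms by (simp add: sum.distrib sum_ind[where g = "\<lambda>_. real m"])
  finally show ?thesis .
qed

text \<open>At \<open>p\<close>, the coordinate \<open>q\<close> detects that \<open>k = q\<close>.
  Then the term at \<open>q\<close> is lost because the blocks agree there, and the doubled term at
  \<open>p\<close> replaces it.\<close>

lemma block_vec_product:
  assumes "M \<subseteq> {..<m}" "card M \<noteq> 1" "k < m"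
  shows "(\<Sum>j<m. if (j \<in> M) \<noteq> (j = k) then \<Sum>c<m + 2. block_vec0 m M j c * block_vec1 m k j c else 0) = 1"
proof (cases "M = {}")
  case True
  have "(\<Sum>j<m. if (j \<in> M) \<noteq> (j = k) then \<Sum>c<m + 2. block_vec0 m M j c * block_vec1 m k j c else 0) =
      (\<Sum>j<m. ind (j = k) * 1)"
    unfolding True sum_block_vec0_empty using assms(3)
    by (intro sum.cong refl) (simp add: block_vec1_def)
  then show ?thesis using assms(3) by (simp only: sum_ind)
next
  case False
  obtain p q where pq: "two_of M = (p, q)" "p \<in> M" "q \<in> M" "p \<noteq> q"
    by (rule two_of[OF finite_subset[OF assms(1)] False assms(2)]) auto
  then have lt: "p < m" "q < m" using assms(1) by auto
  have "(\<Sum>j<m. if (j \<in> M) \<noteq> (j = k) then \<Sum>c<m + 2. block_vec0 m M j c * block_vec1 m k j c else 0) =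
      (\<Sum>j<m. ind (j = p) * (ind (p \<noteq> k) * (1 + ind (q = k)) / 2) + ind (j = q) * (ind (q \<noteq> k) * (1 + ind (p = k)) / 2))"
    unfolding sum_block_vec0[OF pq(1) False lt] using pq(2-4) lt assms(3)
    by (intro sum.cong refl) (auto simp: block_vec1_def)
  also have "\<dots> = ind (p \<noteq> k) * (1 + ind (q = k)) / 2 + ind (q \<noteq> k) * (1 + ind (p = k)) / 2"
    unfolding sum.distrib using lt by (simp only: sum_ind)
  also have "\<dots> = 1" using pq(4) by auto
  finally show ?thesis .
qed

text \<open>Composition with the conjunction: an accepted input uses the vectors of all its blocks,
  a rejected one only those of one chosen bad block. Their product thus reduces to that block, where
  it is 1.\<close>

lemma Q_bounded_error_bound:
  assumes m: "0 < m"
  shows "Q_bounded_error (m\<^sup>2) (boolean_cube (m\<^sup>2)) (f_and_not_exact m) \<le> 31 * m"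
proof -
  define ones where "ones = (\<lambda>(x :: bool list) i. marked m (\<lambda>j. i * m + j) x)"
  define bad where "bad = (\<lambda>x. SOME (i, k). i < m \<and> ones x i = {k})"
  have ones: "ones x i \<subseteq> {..<m}" for x i by (auto simp: ones_def marked_def)
  have f: "f_and_not_exact m x \<longleftrightarrow> (\<forall>i<m. card (ones x i) \<noteq> 1)" for x
    by (simp add: f_and_not_exact_iff Exact_one_block ones_def)
  have bad: "fst (bad y) < m \<and> ones y (fst (bad y)) = {snd (bad y)} \<and> snd (bad y) < m"
    if y: "\<not> f_and_not_exact m y" for y
  proof -
    obtain i where "i < m" "card (ones y i) = 1" using y unfolding f by blast
    moreover from this(2) obtain k where "ones y i = {k}" by (rule card_1_singletonE)
    ultimately have "case (i, k) of (i, k) \<Rightarrow> i < m \<and> ones y i = {k}" by simp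
    then have "case bad y of (i, k) \<Rightarrow> i < m \<and> ones y i = {k}" unfolding bad_def by (rule someI)
    then show ?thesis using ones[of y "fst (bad y)"] by (auto split: prod.splits)
  qed
  define u where "u = (\<lambda>x l. block_vec0 m (ones x (l div m)) (l mod m))"
  define v where "v = (\<lambda>y l c. if l div m = fst (bad y) then block_vec1 m (snd (bad y)) (l mod m) c else 0)"
  \<comment> \<open>The left side is \<open>3 + 900 * m^2\<close>, at most \<open>903 * m^2\<close>,
    and 31 is the least integer whose square reaches 903.\<close>
  have T: "3 * (1 + 100 * real m * real (3 * m)) \<le> (real (31 * m))\<^sup>2"
  proof -
    have "1 \<le> (real m)\<^sup>2" using m by simp
    then show ?thesis by (simp add: power2_eq_square)
  qed
  have "\<exists>A. computes_bounded_error (m\<^sup>2) (boolean_cube (m\<^sup>2)) (f_and_not_exact m) A \<and> queries A = 31 * m"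
  proof (rule dual_adversary_algorithm[where u = u and v = v and C = "m + 2" and A = "real m" and B = "real (3 * m)"])
    fix x assume x: "f_and_not_exact m x"
    have "(\<Sum>l<m\<^sup>2. \<Sum>c<m + 2. (u x l c)\<^sup>2) = (\<Sum>i<m. \<Sum>j<m. \<Sum>c<m + 2. (block_vec0 m (ones x i) j c)\<^sup>2)"
      unfolding power2_eq_square[of m] sum_div_mod by (intro sum.cong refl) (simp add: u_def)
    also have "\<dots> = (\<Sum>i<m. 1)"
      using x f by (intro sum.cong refl block_vec0_size[OF m ones]) auto
    finally show "(\<Sum>l<m\<^sup>2. \<Sum>c<m + 2. (u x l c)\<^sup>2) \<le> real m" by simp
  next
    fix y assume y: "\<not> f_and_not_exact m y"
    have "(\<Sum>l<m\<^sup>2. \<Sum>c<m + 2. (v y l c)\<^sup>2) = (\<Sum>i<m. \<Sum>j<m. \<Sum>c<m + 2.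
        if i = fst (bad y) then (block_vec1 m (snd (bad y)) j c)\<^sup>2 else 0)"
      unfolding power2_eq_square[of m] sum_div_mod by (intro sum.cong refl) (simp add: v_def)
    also have "\<dots> = (\<Sum>i<m. if i = fst (bad y) then \<Sum>j<m. \<Sum>c<m + 2. (block_vec1 m (snd (bad y)) j c)\<^sup>2 else 0)"
      by (intro sum.cong refl) simp
    also have "\<dots> = (\<Sum>j<m. \<Sum>c<m + 2. (block_vec1 m (snd (bad y)) j c)\<^sup>2)" using bad[OF y] by simp
    also have "\<dots> \<le> 3 * m" by (rule block_vec1_size) (use bad[OF y] in simp)
    finally show "(\<Sum>l<m\<^sup>2. \<Sum>c<m + 2. (v y l c)\<^sup>2) \<le> real (3 * m)" by simp
  next
    fix x y assume x: "f_and_not_exact m x" and y: "\<not> f_and_not_exact m y"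
    let ?i = "fst (bad y)" and ?k = "snd (bad y)"
    have "(\<Sum>l<m\<^sup>2. if x ! l \<noteq> y ! l then \<Sum>c<m + 2. u x l c * v y l c else 0) =
      (\<Sum>i<m. \<Sum>j<m. if x ! (i * m + j) \<noteq> y ! (i * m + j) then \<Sum>c<m + 2. block_vec0 m (ones x i) j c *
        (if i = ?i then block_vec1 m ?k j c else 0) else 0)"
      unfolding power2_eq_square[of m] sum_div_mod by (intro sum.cong refl) (simp add: u_def v_def)
    also have "\<dots> = (\<Sum>i<m. if i = ?i then \<Sum>j<m. if (j \<in> ones x i) \<noteq> (j = ?k)
        then \<Sum>c<m + 2. block_vec0 m (ones x i) j c * block_vec1 m ?k j c else 0 else 0)"
    proof (rule sum.cong[OF refl])
      fix i assume "i \<in> {..<m}"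
      have "j \<in> ones x i \<longleftrightarrow> x ! (i * m + j)" "i = ?i \<Longrightarrow> j = ?k \<longleftrightarrow> y ! (i * m + j)" if "j < m" for j
        using that bad[OF y] by (auto simp: ones_def marked_def)
      then show "(\<Sum>j<m. if x ! (i * m + j) \<noteq> y ! (i * m + j) then \<Sum>c<m + 2. block_vec0 m (ones x i) j c *
        (if i = ?i then block_vec1 m ?k j c else 0) else 0) = (if i = ?i then \<Sum>j<m. if (j \<in> ones x i) \<noteq> (j = ?k)
        then \<Sum>c<m + 2. block_vec0 m (ones x i) j c * block_vec1 m ?k j c else 0 else 0)"
        by (cases "i = ?i") (simp_all cong: if_cong)
    qed
    also have "\<dots> = (\<Sum>j<m. if (j \<in> ones x ?i) \<noteq> (j = ?k)
        then \<Sum>c<m + 2. block_vec0 m (ones x ?i) j c * block_vec1 m ?k j c else 0)"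
      using bad[OF y] by simp
    also have "\<dots> = 1" by (rule block_vec_product[OF ones]) (use bad[OF y] x f in auto)
    finally show "(\<Sum>l<m\<^sup>2. if x ! l \<noteq> y ! l then \<Sum>c<m + 2. u x l c * v y l c else 0) = 1" .
  qed (use m T in auto)
  then show ?thesis unfolding Q_bounded_error_def by (intro Least_le)
qed

theorem lemma55:
  shows "(\<lambda>m. real (Q_zero_error (m\<^sup>2) (boolean_cube (m\<^sup>2)) (f_and_not_exact m)))
            \<in> O(\<lambda>m. real m powr (3 / 2))
       \<and> (\<lambda>m. real (Q_bounded_error (m\<^sup>2) (boolean_cube (m\<^sup>2)) (f_and_not_exact m)))
            \<in> O(\<lambda>m. real m)"
proof
  \<comment> \<open>Here \<open>41 = 5 * 4 * 2 + 1\<close>: rounding up at most doubles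
    \<open>sqrt m\<close>, and the final reading costs \<open>m\<close>, at most
    \<open>m * sqrt m\<close>.\<close>
  have "real (Q_zero_error (m\<^sup>2) (boolean_cube (m\<^sup>2)) (f_and_not_exact m)) \<le> 41 * real m powr (3 / 2)"
    if m: "0 < m" for m
  proof -
    have "real m powr (3 / 2) = real m powr (1 + 1 / 2)" by simp
    also have "\<dots> = real m * sqrt m" using m by (simp only: powr_add) (simp add: powr_half_sqrt)
    finally have pw: "real m powr (3 / 2) = real m * sqrt m" .
    have s: "1 \<le> sqrt m" using m by simp
    then have "real (nat \<lceil>sqrt m\<rceil>) \<le> 2 * sqrt m" using ceiling_correct[of "sqrt m"] by linarith
    then have "20 * real m * real (nat \<lceil>sqrt m\<rceil>) \<le> 20 * real m * (2 * sqrt m)" by (intro mult_left_mono) auto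
    moreover have "real m * 1 \<le> real m * sqrt m" using s by (intro mult_left_mono) auto
    moreover have "real (Q_zero_error (m\<^sup>2) (boolean_cube (m\<^sup>2)) (f_and_not_exact m)) \<le>
        real (5 * m * (4 * nat \<lceil>sqrt m\<rceil>) + m)"
      using Q_zero_error_bound[OF m] by (simp only: of_nat_le_iff)
    ultimately show ?thesis unfolding pw by simp
  qed
  then show "(\<lambda>m. real (Q_zero_error (m\<^sup>2) (boolean_cube (m\<^sup>2)) (f_and_not_exact m)))
            \<in> O(\<lambda>m. real m powr (3 / 2))"
    by (intro bigoI[where c = 41] eventually_at_top_linorderI[of 1]) simp
  have "real (Q_bounded_error (m\<^sup>2) (boolean_cube (m\<^sup>2)) (f_and_not_exact m)) \<le> 31 * real m" if "0 < m" for m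
    using Q_bounded_error_bound[OF that] by linarith
  then show "(\<lambda>m. real (Q_bounded_error (m\<^sup>2) (boolean_cube (m\<^sup>2)) (f_and_not_exact m))) \<in> O(\<lambda>m. real m)"
    by (intro bigoI[where c = 31] eventually_at_top_linorderI[of 1]) simp
qed

end
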